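(* Let $m\ge 3$, $0\le \nu\le m$, $p=m-2$, and let $\Sigma\subset\mathbb{R}^m_\nu$ be a 2-dimensional orientable pseudo-Riemannian submanifold, equipped with a symplectic form $\omega$ and the associated Poisson bracket $\{\cdot,\cdot\}$ on $C^\infty(\Sigma)$. Let $x^1,\dots,x^m$ denote the restrictions to $\Sigma$ of the standard coordinates of $\mathbb{R}^m_\nu$. In local coordinates $u^1,u^2$ of $\Sigma$ write $\omega=\rho\,\mathrm{d}u^1\wedge \mathrm{d}u^2$ and $g=\det(g_{ab})$. Then the Gauss curvature $K$ and the mean curvature vector $H$ of $\Sigma$ are given by $$K=-\frac{\rho^4}{8g^2(p-1)!}\sum_{L}\sum_{i,j,k,l,r,n=1}^m\bar g_i\bar g_r\bar g_n\,\epsilon_{jklL}\,\epsilon_{irnL}\,\{x^i,\{x^k,x^l\}\}\,\{x^j,\{x^r,x^n\}\},$$ $$H=\frac{\rho^4}{8g^2(p-1)!}\sum_{L}\sum_{k'=1}^m\sum_{i,j,k,l,r,n=1}^m\bar g_j\bar g_k\bar g_l\,\epsilon_{irnL}\,\epsilon_{k'klL}\,\{x^i,x^j\}\,\{x^j,\{x^r,x^n\}\}\,\{x^k,x^l\}\,\partial_{k'},$$ where $L$ runs over all multi-indices in $\{1,\dots,m\}^{p-1}$.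
   Context: $\mathbb{R}^m_\nu$ is $\mathbb{R}^m$ with the constant metric $\bar g_{ij}=\delta_{ij}\bar g_j$, where $\bar g_1=\dots=\bar g_\nu=-1$ and $\bar g_{\nu+1}=\dots=\bar g_m=1$; $\bar\nabla$ is its Levi-Civita (flat) connection and $\partial_k$ are the standard coordinate vector fields. $\epsilon_{i_1\dots i_m}$ is the totally antisymmetric symbol with $\epsilon_{1\dots m}=1$, and $\epsilon_{jklL}$ with $L=(l_1,\dots,l_{p-1})$ means $\epsilon_{jkl\,l_1\dots l_{p-1}}$ (if $p=1$, $L$ is the empty multi-index). A pseudo-Riemannian submanifold $\Sigma$ is one on which the induced metric is non-degenerate. With local coordinates $u^1,u^2$ on $\Sigma$, set $e_a=(\partial_a x^i)\partial_i$ and $g_{ab}=\bar g(e_a,e_b)$; $(g^{ab})$ is the inverse matrix of $(g_{ab})$ and $g=\det(g_{ab})\neq 0$. Poisson bracket: for the symplectic form $\omega=\rho\,\mathrm{d}u^1\wedge\mathrm{d}u^2$ (so $\rho$ is nowhere zero), $\{f,h\}=\frac1\rho\sum_{a,b=1}^2\epsilon^{ab}(\partial_a f)(\partial_b h)$ for $f,h\in C^\infty(\Sigma)$, where $\epsilon^{12}=-\epsilon^{21}=1$, $\epsilon^{11}=\epsilon^{22}=0$. Gauss curvature: $K=\frac1g\,\bar g(R(e_1,e_2)e_1,e_2)$, where $R$ is the curvature tensor of the Levi-Civita connection $\nabla$ of $\Sigma$ with the sign convention $R(X,Y)Z=\nabla_{[X,Y]}Z-[\nabla_X,\nabla_Y]Z$.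 Equivalently, since the ambient space is flat, $K=\frac1g\left[\bar g(I\!I(e_1,e_1),I\!I(e_2,e_2))-\bar g(I\!I(e_1,e_2),I\!I(e_1,e_2))\right]$. Shape tensor and mean curvature vector: $I\!I(X,Y)$ is the component of $\bar\nabla_XY$ normal to $\Sigma$ (for $X,Y$ tangent to $\Sigma$), and $H=\frac12 \sum_{a,b}g^{ab}I\!I(e_a,e_b)$. *)

theory Defs
  imports "HOL-Analysis.Analysis" "HOL-Combinatorics.Permutations"
begin

text \<open>
  \<open>\<real>\<^sup>m\<close> is \<open>real ^ 'm\<close> for a finite linearly ordered index type with \<open>m = CARD('m)\<close>.
  The linear order supplies the numbering \<open>1, \<dots>, m\<close> of the coordinates: the index \<open>i\<close>
  has number \<open>card {..i}\<close>.
\<close>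

section \<open>Smooth maps on open sets\<close>

definition partial :: "2 \<Rightarrow> (real^2 \<Rightarrow> 'b::real_normed_vector) \<Rightarrow> real^2 \<Rightarrow> 'b" where
  "partial a f u = frechet_derivative f (at u) (axis a 1)"

primrec Ck_on :: "nat \<Rightarrow> ('a::real_normed_vector \<Rightarrow> 'b::real_normed_vector) \<Rightarrow> 'a set \<Rightarrow> bool" where
  "Ck_on 0 f U \<longleftrightarrow> continuous_on U f"
| "Ck_on (Suc k) f U \<longleftrightarrow>
     (\<forall>u\<in>U. f differentiable (at u)) \<and>
     (\<forall>v. Ck_on k (\<lambda>u. frechet_derivative f (at u) v) U)"

definition smooth_on :: "'a::real_normed_vector set \<Rightarrow> ('a \<Rightarrow> 'b::real_normed_vector) \<Rightarrow> bool" where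
  "smooth_on U f \<longleftrightarrow> (\<forall>k. Ck_on k f U)"

section \<open>The ambient space\<close>

definition gbar :: "nat \<Rightarrow> 'm::{finite,linorder} \<Rightarrow> real" where
  "gbar \<nu> i = (if card {..i} \<le> \<nu> then - 1 else 1)"

definition ambient_metric :: "nat \<Rightarrow> real^'m::{finite,linorder} \<Rightarrow> real^'m::{finite,linorder} \<Rightarrow> real" where
  "ambient_metric \<nu> v w = (\<Sum>i\<in>UNIV. gbar \<nu> i * v $ i * w $ i)"

text \<open>
  The totally antisymmetric symbol, for index lists of length \<open>m\<close>: a list without repetition
  is the permutation sending the \<open>k\<close>-th index to the \<open>k\<close>-th list entry (list positions
  start at 0, hence the strict inequality in \<open>{..<i}\<close>).
\<close>

definition eps :: "'m::{finite,linorder} list \<Rightarrow> real" where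
  "eps js = (if distinct js then of_int (sign (\<lambda>i. js ! card {..<i})) else 0)"

definition eps2 :: "2 \<Rightarrow> 2 \<Rightarrow> real" where
  "eps2 a b = (if a = 1 \<and> b = 2 then 1 else if a = 2 \<and> b = 1 then - 1 else 0)"

section \<open>Surfaces in the ambient space\<close>

text \<open>
  Submanifolds are embedded. Local coordinates \<open>u\<^sup>1, u\<^sup>2\<close> are given by their inverse, a local
  parametrization \<open>\<phi> : U \<rightarrow> S\<close> onto a relatively open part of the surface.
\<close>

definition local_param :: "(real^'m) set \<Rightarrow> (real^2) set \<Rightarrow> (real^2 \<Rightarrow> real^'m) \<Rightarrow> bool" where
  "local_param S U \<phi> \<longleftrightarrow>
     open U \<and> smooth_on U \<phi> \<and>
     \<phi> ` U \<subseteq> S \<and> openin (top_of_set S) (\<phi> ` U) \<and>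
     (\<exists>\<psi>. homeomorphism U (\<phi> ` U) \<phi> \<psi>) \<and>
     (\<forall>u\<in>U. inj (frechet_derivative \<phi> (at u)))"

definition submanifold2 :: "(real^'m) set \<Rightarrow> bool" where
  "submanifold2 S \<longleftrightarrow> (\<forall>q\<in>S. \<exists>U \<phi>. local_param S U \<phi> \<and> q \<in> \<phi> ` U)"

text \<open>The tangent space of the surface at the point \<open>\<phi> u\<close>.\<close>

definition tangent :: "(real^2 \<Rightarrow> real^'m) \<Rightarrow> real^2 \<Rightarrow> (real^'m) set" where
  "tangent \<phi> u = range (frechet_derivative \<phi> (at u))"

definition pseudo_riemannian_surface :: "nat \<Rightarrow> (real^'m::{finite,linorder}) set \<Rightarrow> bool" where
  "pseudo_riemannian_surface \<nu> S \<longleftrightarrow>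
     submanifold2 S \<and>
     (\<forall>U \<phi>. local_param S U \<phi> \<longrightarrow>
        (\<forall>u\<in>U. \<forall>v\<in>tangent \<phi> u. (\<forall>w\<in>tangent \<phi> u. ambient_metric \<nu> v w = 0) \<longrightarrow> v = 0))"

definition orientable_surface :: "(real^'m) set \<Rightarrow> bool" where
  "orientable_surface S \<longleftrightarrow>
     (\<exists>A. (\<forall>(U, \<phi>)\<in>A. local_param S U \<phi>) \<and>
          S \<subseteq> (\<Union>(U, \<phi>)\<in>A. \<phi> ` U) \<and>
          (\<forall>(U, \<phi>)\<in>A. \<forall>(V, \<psi>)\<in>A. \<forall>u\<in>U. \<phi> u \<in> \<psi> ` V \<longrightarrow>
              det (jacobian (the_inv_into V \<psi> \<circ> \<phi>) (at u)) > 0))"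

section \<open>Symplectic forms and the Poisson bracket\<close>

text \<open>
  A 2-form is a family \<open>\<omega> q\<close> of functions of two vectors of which only the values on tangent
  vectors of the surface at \<open>q\<close> matter. The last clause is \<open>d\<omega> = 0\<close> in local coordinates
  (automatic in dimension two).
\<close>

definition form_coeff ::
  "(real^'m \<Rightarrow> real^'m \<Rightarrow> real^'m \<Rightarrow> real) \<Rightarrow> (real^2 \<Rightarrow> real^'m) \<Rightarrow> 2 \<Rightarrow> 2 \<Rightarrow> real^2 \<Rightarrow> real" where
  "form_coeff \<omega> \<phi> a b u = \<omega> (\<phi> u) (partial a \<phi> u) (partial b \<phi> u)"

definition symplectic_form ::
  "(real^'m) set \<Rightarrow> (real^'m \<Rightarrow> real^'m \<Rightarrow> real^'m \<Rightarrow> real) \<Rightarrow> bool" where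
  "symplectic_form S \<omega> \<longleftrightarrow>
     (\<forall>U \<phi>. local_param S U \<phi> \<longrightarrow>
        (\<forall>u\<in>U. \<forall>v\<in>tangent \<phi> u. \<forall>w\<in>tangent \<phi> u. \<forall>z\<in>tangent \<phi> u. \<forall>c d.
            \<omega> (\<phi> u) (c *\<^sub>R v + d *\<^sub>R w) z = c * \<omega> (\<phi> u) v z + d * \<omega> (\<phi> u) w z) \<and>
        (\<forall>u\<in>U. \<forall>v\<in>tangent \<phi> u. \<forall>w\<in>tangent \<phi> u. \<omega> (\<phi> u) v w = - \<omega> (\<phi> u) w v) \<and>
        (\<forall>u\<in>U. \<forall>v\<in>tangent \<phi> u. (\<forall>w\<in>tangent \<phi> u. \<omega> (\<phi> u) v w = 0) \<longrightarrow> v = 0) \<and>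
        (\<forall>a b. smooth_on U (form_coeff \<omega> \<phi> a b)) \<and>
        (\<forall>u\<in>U. \<forall>a b c.
            partial a (form_coeff \<omega> \<phi> b c) u + partial b (form_coeff \<omega> \<phi> c a) u
              + partial c (form_coeff \<omega> \<phi> a b) u = 0))"

text \<open>\<open>\<omega> = \<rho> du\<^sup>1 \<and> du\<^sup>2\<close>, so \<open>\<rho> = \<omega>(e\<^sub>1, e\<^sub>2)\<close>.\<close>

definition rho ::
  "(real^'m \<Rightarrow> real^'m \<Rightarrow> real^'m \<Rightarrow> real) \<Rightarrow> (real^2 \<Rightarrow> real^'m) \<Rightarrow> real^2 \<Rightarrow> real" where
  "rho \<omega> \<phi> u = form_coeff \<omega> \<phi> 1 2 u"

definition poisson_local ::
  "(real^'m \<Rightarrow> real^'m \<Rightarrow> real^'m \<Rightarrow> real) \<Rightarrow> (real^2 \<Rightarrow> real^'m) \<Rightarrow>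
     (real^'m \<Rightarrow> real) \<Rightarrow> (real^'m \<Rightarrow> real) \<Rightarrow> real^2 \<Rightarrow> real" where
  "poisson_local \<omega> \<phi> f h u =
     1 / rho \<omega> \<phi> u *
       (\<Sum>a\<in>UNIV. \<Sum>b\<in>UNIV. eps2 a b * partial a (f \<circ> \<phi>) u * partial b (h \<circ> \<phi>) u)"

text \<open>
  The bracket of two functions on the surface (only their values on \<open>S\<close> matter): its value at
  \<open>q\<close> is the number that the coordinate formula gives in every local parametrization around
  \<open>q\<close>; for \<open>f\<close> and \<open>h\<close> smooth on the surface this number exists and is unique.
\<close>

definition poisson ::
  "(real^'m) set \<Rightarrow> (real^'m \<Rightarrow> real^'m \<Rightarrow> real^'m \<Rightarrow> real) \<Rightarrow>
     (real^'m \<Rightarrow> real) \<Rightarrow> (real^'m \<Rightarrow> real) \<Rightarrow> real^'m \<Rightarrow> real" where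
  "poisson S \<omega> f h q =
     (THE c. \<forall>U \<phi> u. local_param S U \<phi> \<and> u \<in> U \<and> \<phi> u = q \<longrightarrow> c = poisson_local \<omega> \<phi> f h u)"

definition coord :: "'m \<Rightarrow> real^'m \<Rightarrow> real" where
  "coord i q = q $ i"

section \<open>Induced metric, Levi-Civita connection and Gauss curvature\<close>

definition metric_matrix ::
  "nat \<Rightarrow> (real^2 \<Rightarrow> real^'m::{finite,linorder}) \<Rightarrow> real^2 \<Rightarrow> real^2^2" where
  "metric_matrix \<nu> \<phi> u = (\<chi> a b. ambient_metric \<nu> (partial a \<phi> u) (partial b \<phi> u))"

definition metric_det ::
  "nat \<Rightarrow> (real^2 \<Rightarrow> real^'m::{finite,linorder}) \<Rightarrow> real^2 \<Rightarrow> real" where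
  "metric_det \<nu> \<phi> u = det (metric_matrix \<nu> \<phi> u)"

definition christoffel ::
  "nat \<Rightarrow> (real^2 \<Rightarrow> real^'m::{finite,linorder}) \<Rightarrow> 2 \<Rightarrow> 2 \<Rightarrow> 2 \<Rightarrow> real^2 \<Rightarrow> real" where
  "christoffel \<nu> \<phi> c a b u =
     1 / 2 * (\<Sum>d\<in>UNIV. matrix_inv (metric_matrix \<nu> \<phi> u) $ c $ d *
        (partial a (\<lambda>v. metric_matrix \<nu> \<phi> v $ b $ d) u
         + partial b (\<lambda>v. metric_matrix \<nu> \<phi> v $ a $ d) u
         - partial d (\<lambda>v. metric_matrix \<nu> \<phi> v $ a $ b) u))"

text \<open>
  Tangent vector fields on a coordinate patch are represented by their components
  \<open>X : U \<rightarrow> \<real>\<^sup>2\<close> in the frame \<open>e\<^sub>1, e\<^sub>2\<close>; the field itself is \<open>u \<mapsto> frechet_derivative \<phi> (at u) (X u)\<close>.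
\<close>

definition levi_civita ::
  "nat \<Rightarrow> (real^2 \<Rightarrow> real^'m::{finite,linorder}) \<Rightarrow>
     (real^2 \<Rightarrow> real^2) \<Rightarrow> (real^2 \<Rightarrow> real^2) \<Rightarrow> real^2 \<Rightarrow> real^2" where
  "levi_civita \<nu> \<phi> X Y u =
     frechet_derivative Y (at u) (X u) +
       (\<chi> c. \<Sum>a\<in>UNIV. \<Sum>b\<in>UNIV. christoffel \<nu> \<phi> c a b u * X u $ a * Y u $ b)"

definition lie_bracket ::
  "(real^2 \<Rightarrow> real^2) \<Rightarrow> (real^2 \<Rightarrow> real^2) \<Rightarrow> real^2 \<Rightarrow> real^2" where
  "lie_bracket X Y u = frechet_derivative Y (at u) (X u) - frechet_derivative X (at u) (Y u)"

text \<open>Sign convention: \<open>R(X,Y)Z = \<nabla>\<^bsub>[X,Y]\<^esub>Z - [\<nabla>\<^bsub>X\<^esub>, \<nabla>\<^bsub>Y\<^esub>]Z\<close>.\<close>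

definition curvature_tensor ::
  "nat \<Rightarrow> (real^2 \<Rightarrow> real^'m::{finite,linorder}) \<Rightarrow>
     (real^2 \<Rightarrow> real^2) \<Rightarrow> (real^2 \<Rightarrow> real^2) \<Rightarrow> (real^2 \<Rightarrow> real^2) \<Rightarrow> real^2 \<Rightarrow> real^2" where
  "curvature_tensor \<nu> \<phi> X Y Z u =
     levi_civita \<nu> \<phi> (lie_bracket X Y) Z u
       - (levi_civita \<nu> \<phi> X (levi_civita \<nu> \<phi> Y Z) u
          - levi_civita \<nu> \<phi> Y (levi_civita \<nu> \<phi> X Z) u)"

definition frame :: "2 \<Rightarrow> real^2 \<Rightarrow> real^2" where
  "frame a u = axis a 1"

definition gauss_curvature ::
  "nat \<Rightarrow> (real^2 \<Rightarrow> real^'m::{finite,linorder}) \<Rightarrow> real^2 \<Rightarrow> real" where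
  "gauss_curvature \<nu> \<phi> u =
     1 / metric_det \<nu> \<phi> u *
       ambient_metric \<nu>
         (frechet_derivative \<phi> (at u) (curvature_tensor \<nu> \<phi> (frame 1) (frame 2) (frame 1) u))
         (partial 2 \<phi> u)"

section \<open>Shape tensor and mean curvature vector\<close>

definition normal_part ::
  "nat \<Rightarrow> (real^2 \<Rightarrow> real^'m::{finite,linorder}) \<Rightarrow> real^2 \<Rightarrow> real^'m::{finite,linorder} \<Rightarrow> real^'m::{finite,linorder}" where
  "normal_part \<nu> \<phi> u v =
     (THE n. (\<forall>w\<in>tangent \<phi> u. ambient_metric \<nu> n w = 0) \<and> v - n \<in> tangent \<phi> u)"

text \<open>
  As the ambient connection is flat, the ambient derivative of the field \<open>Y\<close> along \<open>X\<close> is the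
  directional derivative of the vector-valued map \<open>u \<mapsto> frechet_derivative \<phi> (at u) (Y u)\<close>.
\<close>

definition shape_tensor ::
  "nat \<Rightarrow> (real^2 \<Rightarrow> real^'m::{finite,linorder}) \<Rightarrow>
     (real^2 \<Rightarrow> real^2) \<Rightarrow> (real^2 \<Rightarrow> real^2) \<Rightarrow> real^2 \<Rightarrow> real^'m::{finite,linorder}" where
  "shape_tensor \<nu> \<phi> X Y u =
     normal_part \<nu> \<phi> u
       (frechet_derivative (\<lambda>v. frechet_derivative \<phi> (at v) (Y v)) (at u) (X u))"

definition mean_curvature ::
  "nat \<Rightarrow> (real^2 \<Rightarrow> real^'m::{finite,linorder}) \<Rightarrow> real^2 \<Rightarrow> real^'m::{finite,linorder}" where
  "mean_curvature \<nu> \<phi> u =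
     (1 / 2) *\<^sub>R (\<Sum>a\<in>UNIV. \<Sum>b\<in>UNIV.
        matrix_inv (metric_matrix \<nu> \<phi> u) $ a $ b *\<^sub>R shape_tensor \<nu> \<phi> (frame a) (frame b) u)"

end

theory Submission
  imports Defs
begin

text \<open>
  Let \<open>e\<^sub>a = \<partial>\<^sub>a \<phi>\<close> be the coordinate frame and \<open>h\<^sub>a\<^sub>b = \<partial>\<^sub>a \<partial>\<^sub>b \<phi>\<close>. For a multi-index \<open>L\<close> write
  \<open>vol L a b c\<close> for the contraction of \<open>\<epsilon>\<^sub>j\<^sub>k\<^sub>l\<^sub>L\<close> with three vectors; it is trilinear and alternating.
  Three observations give both formulas.

  First, the brackets \<open>{x\<^sup>k, x\<^sup>l}\<close> are the components of the bivector \<open>e\<^sub>1 \<and> e\<^sub>2 / \<rho>\<close>, and in both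
  sums an \<open>\<epsilon>\<close>-symbol pairs a derivative \<open>\<partial>\<^sub>b (e\<^sub>1 \<and> e\<^sub>2 / \<rho>)\<close> with a tangent vector
  \<open>e\<^sub>c\<close>. Because \<open>e\<^sub>c \<and> e\<^sub>1 \<and> e\<^sub>2 = 0\<close>, the derivative of \<open>1 / \<rho>\<close> drops out, and what survives is
  \<open>- 2 / \<rho>\<close> times \<open>vol L e\<^sub>1 e\<^sub>2 h\<^sub>b\<^sub>c\<close> (lemma \<open>eps_pairing_wedge_deriv\<close>). For the same reason
  \<open>h\<^sub>b\<^sub>c\<close> may be replaced by its normal part \<open>II\<^sub>b\<^sub>c\<close>.

  Secondly, summing a product of two \<open>\<epsilon>\<close>-symbols over the \<open>m - 3\<close> common indices yields
  \<open>(m - 3)!\<close> times a Gram determinant (lemma \<open>vol_contraction\<close>). Since \<open>II\<close> is orthogonal to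
  \<open>e\<^sub>1\<close> and \<open>e\<^sub>2\<close>, that determinant splits off the factor \<open>g\<close>: it is \<open>g \<langle>II\<^sub>a\<^sub>b, II\<^sub>c\<^sub>d\<rangle>\<close> when both factors
  contain second derivatives, and \<open>g\<close> times a component of \<open>II\<^sub>a\<^sub>b\<close> when the second one contains a
  coordinate axis instead (lemma \<open>sum_vol_h\<close>).

  Thirdly, the signs \<open>\<epsilon>\<^sup>a\<^sup>b \<epsilon>\<^sup>c\<^sup>d\<close> of the brackets that are not paired with \<open>\<epsilon>\<close> assemble the products into
  \<open>\<langle>II\<^sub>1\<^sub>1, II\<^sub>2\<^sub>2\<rangle> - \<langle>II\<^sub>1\<^sub>2, II\<^sub>1\<^sub>2\<rangle>\<close>, which is \<open>g K\<close> by the Gauss equation, respectively into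
  \<open>g\<^sub>2\<^sub>2 II\<^sub>1\<^sub>1 - 2 g\<^sub>1\<^sub>2 II\<^sub>1\<^sub>2 + g\<^sub>1\<^sub>1 II\<^sub>2\<^sub>2\<close>, which is \<open>2 g H\<close> because the inverse metric is the adjugate
  of the metric divided by \<open>g\<close>.

  Two things have to be established before this computation can start. The bracket is
  characterised by its value in all local parametrizations simultaneously, so its independence
  of the parametrization is needed (lemma \<open>poisson_eq_local\<close>); it rests on the differentiability
  of transition maps and on the fact that \<open>\<rho>\<close> and the numerator of the bracket are multiplied by the same
  Jacobian determinant. And \<open>K\<close> is given intrinsically by the Christoffel symbols, so
  the Gauss equation has to be derived (lemma \<open>gauss_equation\<close>); the third derivatives of \<open>\<phi>\<close>
  cancel in it because mixed derivatives agree (lemma \<open>partial_commute\<close>).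
\<close>

section \<open>Partial derivatives and their symmetry\<close>

lemma smooth_on_differentiable:
  assumes "smooth_on U f" "u \<in> U"
  shows "f differentiable (at u)"
proof -
  have "Ck_on (Suc 0) f U" using assms(1) unfolding smooth_on_def by blast
  then show ?thesis using assms(2) by simp
qed

lemma smooth_on_partial:
  assumes "smooth_on U f"
  shows "smooth_on U (partial a f)"
  unfolding smooth_on_def
proof
  fix k
  have "Ck_on (Suc k) f U" using assms unfolding smooth_on_def by blast
  then show "Ck_on k (partial a f) U" unfolding partial_def by simp
qed

lemma partial_eqI: "(f has_derivative f') (at u) \<Longrightarrow> partial a f u = f' (axis a 1)"
  by (metis partial_def frechet_derivative_at)

lemma partial_cong:
  assumes "\<And>v. v \<in> U \<Longrightarrow> f v = h v" "open U" "u \<in> U" "h differentiable (at u)"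
  shows "partial a f u = partial a h u"
proof -
  have "(h has_derivative frechet_derivative h (at u)) (at u)"
    using assms(4) frechet_derivative_works by blast
  then have "(f has_derivative frechet_derivative h (at u)) (at u)"
    by (rule has_derivative_transform_within_open[OF _ assms(2,3)]) (simp add: assms(1))
  then show ?thesis by (simp add: partial_eqI) (simp add: partial_def)
qed

lemma differentiable_cong:
  assumes "\<And>v. v \<in> U \<Longrightarrow> f v = h v" "open U" "u \<in> U" "h differentiable (at u)"
  shows "f differentiable (at u)"
  using assms has_derivative_transform_within_open[of h _ u UNIV U f]
  unfolding differentiable_def by metis

lemma vec2_expand: "(x :: real^2) = x $ 1 *\<^sub>R axis 1 1 + x $ 2 *\<^sub>R axis 2 1"
  by (simp add: vec_eq_iff forall_2 axis_def)

lemma linear_vec2: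
  fixes f :: "real^2 \<Rightarrow> 'b::real_normed_vector"
  assumes "linear f"
  shows "f x = x $ 1 *\<^sub>R f (axis 1 1) + x $ 2 *\<^sub>R f (axis 2 1)"
  by (subst vec2_expand) (simp add: linear_add[OF assms] linear_scale[OF assms])

lemma has_derivative_partial:
  assumes "f differentiable (at u)"
  shows "(f has_derivative (\<lambda>x. x $ 1 *\<^sub>R partial 1 f u + x $ 2 *\<^sub>R partial 2 f u)) (at u)"
    and "frechet_derivative f (at u) x = x $ 1 *\<^sub>R partial 1 f u + x $ 2 *\<^sub>R partial 2 f u"
proof -
  have d: "(f has_derivative frechet_derivative f (at u)) (at u)"
    using assms frechet_derivative_works by blast
  have e: "frechet_derivative f (at u) x = x $ 1 *\<^sub>R partial 1 f u + x $ 2 *\<^sub>R partial 2 f u" for x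
    unfolding partial_def by (rule linear_vec2) (rule has_derivative_linear[OF d])
  show "(f has_derivative (\<lambda>x. x $ 1 *\<^sub>R partial 1 f u + x $ 2 *\<^sub>R partial 2 f u)) (at u)"
    using d by (simp add: e[abs_def])
  show "frechet_derivative f (at u) x = x $ 1 *\<^sub>R partial 1 f u + x $ 2 *\<^sub>R partial 2 f u"
    by (rule e)
qed

lemma partial_has_derivative:
  assumes "f differentiable (at u)"
  obtains f' where "(f has_derivative f') (at u)" "\<And>a. partial a f u = f' (axis a 1)"
  using assms unfolding differentiable_def by (metis partial_eqI)

lemma partial_component:
  assumes "f differentiable (at u)"
  shows "partial a (\<lambda>v. f v $ i) u = partial a f u $ i"
    and "(\<lambda>v. f v $ i) differentiable (at u)"
proof -
  obtain f' where f': "(f has_derivative f') (at u)" "\<And>a. partial a f u = f' (axis a 1)"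
    using assms partial_has_derivative by blast
  have "((\<lambda>v. f v $ i) has_derivative (\<lambda>h. f' h $ i)) (at u)"
    by (rule bounded_linear.has_derivative[OF bounded_linear_vec_nth f'(1)])
  then show "partial a (\<lambda>v. f v $ i) u = partial a f u $ i"
    and "(\<lambda>v. f v $ i) differentiable (at u)"
    by (auto simp: partial_eqI f'(2) differentiable_def)
qed

lemma partial_mult:
  fixes f h :: "real^2 \<Rightarrow> real"
  assumes "f differentiable (at u)" "h differentiable (at u)"
  shows "partial a (\<lambda>v. f v * h v) u = partial a f u * h u + f u * partial a h u"
proof -
  obtain f' where f': "(f has_derivative f') (at u)" "\<And>a. partial a f u = f' (axis a 1)"
    using assms(1) partial_has_derivative by blast
  obtain h' where h': "(h has_derivative h') (at u)" "\<And>a. partial a h u = h' (axis a 1)"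
    using assms(2) partial_has_derivative by blast
  show ?thesis
    by (simp add: partial_eqI[OF has_derivative_mult[OF f'(1) h'(1)]] f' h')
qed

lemma partial_add:
  assumes "f differentiable (at u)" "h differentiable (at u)"
  shows "partial a (\<lambda>v. f v + h v) u = partial a f u + partial a h u"
proof -
  obtain f' where f': "(f has_derivative f') (at u)" "\<And>a. partial a f u = f' (axis a 1)"
    using assms(1) partial_has_derivative by blast
  obtain h' where h': "(h has_derivative h') (at u)" "\<And>a. partial a h u = h' (axis a 1)"
    using assms(2) partial_has_derivative by blast
  show ?thesis
    by (simp add: partial_eqI[OF has_derivative_add[OF f'(1) h'(1)]] f' h')
qed

lemma partial_diff:
  assumes "f differentiable (at u)" "h differentiable (at u)"
  shows "partial a (\<lambda>v. f v - h v) u = partial a f u - partial a h u"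
proof -
  obtain f' where f': "(f has_derivative f') (at u)" "\<And>a. partial a f u = f' (axis a 1)"
    using assms(1) partial_has_derivative by blast
  obtain h' where h': "(h has_derivative h') (at u)" "\<And>a. partial a h u = h' (axis a 1)"
    using assms(2) partial_has_derivative by blast
  show ?thesis
    by (simp add: partial_eqI[OF has_derivative_diff[OF f'(1) h'(1)]] f' h')
qed

lemma partial_scaleR:
  fixes f :: "real^2 \<Rightarrow> real"
  assumes "f differentiable (at u)" "h differentiable (at u)"
  shows "partial a (\<lambda>v. f v *\<^sub>R h v) u = partial a f u *\<^sub>R h u + f u *\<^sub>R partial a h u"
proof -
  obtain f' where f': "(f has_derivative f') (at u)" "\<And>a. partial a f u = f' (axis a 1)"
    using assms(1) partial_has_derivative by blast
  obtain h' where h': "(h has_derivative h') (at u)" "\<And>a. partial a h u = h' (axis a 1)"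
    using assms(2) partial_has_derivative by blast
  show ?thesis
    by (simp add: partial_eqI[OF has_derivative_scaleR[OF f'(1) h'(1)]] f' h')
qed

text \<open>
  By the mean value theorem along \<open>v\<close>, the second difference is \<open>t\<close> times an increment
  of the directional derivative of \<open>f\<close> along \<open>v\<close>, and the derivative \<open>A\<close> of that directional
  derivative measures the increment up to \<open>o(t)\<close>.
\<close>

lemma second_difference_bound:
  fixes f :: "'a::real_normed_vector \<Rightarrow> real"
  assumes "open U" "u \<in> U"
    and f: "\<And>y. y \<in> U \<Longrightarrow> f differentiable (at y)"
    and A: "((\<lambda>y. frechet_derivative f (at y) v) has_derivative A) (at u)"
    and "e > 0"
  shows "\<exists>d>0. \<forall>t. 0 < t \<and> t < d \<longrightarrow>
    \<bar>f (u + t *\<^sub>R v + t *\<^sub>R w) - f (u + t *\<^sub>R v) - f (u + t *\<^sub>R w) + f u - t\<^sup>2 * A w\<bar> \<le> e * t\<^sup>2"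
proof -
  define G where "G = (\<lambda>y. frechet_derivative f (at y) v)"
  define N where "N = norm v + norm w + 1"
  have N: "N > 0" unfolding N_def by (simp add: add_nonneg_pos)
  define e' where "e' = e / (2 * N)"
  have e': "e' > 0" using \<open>e > 0\<close> N by (simp add: e'_def)
  have A': "(G has_derivative A) (at u within UNIV)" using A by (simp add: G_def)
  have linA: "linear A" using A by (rule has_derivative_linear)
  obtain d1 where d1: "d1 > 0" "\<And>y. norm (y - u) < d1 \<Longrightarrow> norm (G y - G u - A (y - u)) \<le> e' * norm (y - u)"
    using A'[unfolded has_derivative_within_alt] e' by auto
  obtain d2 where d2: "d2 > 0" "ball u d2 \<subseteq> U"
    using assms(1,2) open_contains_ball by blast
  define d where "d = min d1 d2 / N"
  have dp: "d > 0" using d1(1) d2(1) N by (simp add: d_def)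
  show ?thesis
  proof (intro exI[of _ d] conjI allI impI dp)
    fix t :: real assume t: "0 < t \<and> t < d"
    then have tN: "t * N < d1" "t * N < d2"
      using N by (auto simp: d_def field_simps)
    have nrm: "norm (s *\<^sub>R v + r *\<^sub>R w) \<le> t * N" if "0 \<le> s" "s \<le> t" "0 \<le> r" "r \<le> t" for s r
    proof -
      have "norm (s *\<^sub>R v + r *\<^sub>R w) \<le> s * norm v + r * norm w"
        using norm_triangle_ineq[of "s *\<^sub>R v" "r *\<^sub>R w"] that by simp
      also have "\<dots> \<le> t * norm v + t * norm w"
        using that by (intro add_mono mult_right_mono) auto
      also have "\<dots> \<le> t * N" using t by (simp add: N_def algebra_simps)
      finally show ?thesis .
    qed
    have inU: "u + s *\<^sub>R v + r *\<^sub>R w \<in> U" if "0 \<le> s" "s \<le> t" "0 \<le> r" "r \<le> t" for s r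
    proof -
      have "dist u (u + z) = norm z" for z by (simp add: dist_norm)
      then have "dist u (u + (s *\<^sub>R v + r *\<^sub>R w)) < d2"
        using nrm[OF that] tN by (metis le_less_trans)
      then show ?thesis using d2(2) by (auto simp: add.assoc)
    qed
    have fder: "((\<lambda>s. f (u + s *\<^sub>R v + r *\<^sub>R w)) has_derivative (\<lambda>h. h * G (u + s *\<^sub>R v + r *\<^sub>R w)))
        (at s within {0..t})"
      if "0 \<le> s" "s \<le> t" "0 \<le> r" "r \<le> t" for s r
    proof -
      have D: "(f has_derivative frechet_derivative f (at (u + s *\<^sub>R v + r *\<^sub>R w)))
          (at (u + s *\<^sub>R v + r *\<^sub>R w))"
        using f[OF inU[OF that]] frechet_derivative_works by blast
      have "((\<lambda>s. u + s *\<^sub>R v + r *\<^sub>R w) has_derivative (\<lambda>h. h *\<^sub>R v)) (at s within {0..t})"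
        by (auto intro!: derivative_eq_intros)
      from has_derivative_compose[OF this D]
      show ?thesis
        by (simp add: G_def linear_scale[OF has_derivative_linear[OF D]])
    qed
    define F where "F = (\<lambda>s. f (u + s *\<^sub>R v + t *\<^sub>R w) - f (u + s *\<^sub>R v + 0 *\<^sub>R w))"
    have "(F has_derivative (\<lambda>h. h * G (u + s *\<^sub>R v + t *\<^sub>R w) - h * G (u + s *\<^sub>R v + 0 *\<^sub>R w)))
        (at s within {0..t})" if "0 \<le> s" "s \<le> t" for s
      unfolding F_def using that t by (intro has_derivative_diff fder) auto
    then obtain s where s: "0 < s" "s < t"
      "F t - F 0 = t * G (u + s *\<^sub>R v + t *\<^sub>R w) - t * G (u + s *\<^sub>R v + 0 *\<^sub>R w)"
      using mvt_simple[of 0 t F "\<lambda>s h. h * G (u + s *\<^sub>R v + t *\<^sub>R w) - h * G (u + s *\<^sub>R v + 0 *\<^sub>R w)"] t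
      by auto
    have Gb: "\<bar>G (u + s *\<^sub>R v + r *\<^sub>R w) - G u - A (s *\<^sub>R v + r *\<^sub>R w)\<bar> \<le> e' * (t * N)"
      if "0 \<le> r" "r \<le> t" for r
    proof -
      have n: "norm (s *\<^sub>R v + r *\<^sub>R w) \<le> t * N" using nrm s that by simp
      have "\<bar>G (u + s *\<^sub>R v + r *\<^sub>R w) - G u - A (s *\<^sub>R v + r *\<^sub>R w)\<bar> \<le> e' * norm (s *\<^sub>R v + r *\<^sub>R w)"
        using d1(2)[of "u + s *\<^sub>R v + r *\<^sub>R w"] n tN by (simp add: add.assoc)
      also have "\<dots> \<le> e' * (t * N)" using n e' by (intro mult_left_mono) auto
      finally show ?thesis .
    qed
    have "A (s *\<^sub>R v + t *\<^sub>R w) = A (s *\<^sub>R v + 0 *\<^sub>R w) + t * A w"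
      by (simp add: linear_add[OF linA] linear_scale[OF linA])
    then have "\<bar>G (u + s *\<^sub>R v + t *\<^sub>R w) - G (u + s *\<^sub>R v + 0 *\<^sub>R w) - t * A w\<bar> \<le> 2 * (e' * (t * N))"
      using Gb[of t] Gb[of 0] t by linarith
    also have "\<dots> = e * t" using N by (simp add: e'_def)
    finally have "t * \<bar>G (u + s *\<^sub>R v + t *\<^sub>R w) - G (u + s *\<^sub>R v + 0 *\<^sub>R w) - t * A w\<bar> \<le> t * (e * t)"
      using t by (intro mult_left_mono) auto
    moreover have "t * \<bar>G (u + s *\<^sub>R v + t *\<^sub>R w) - G (u + s *\<^sub>R v + 0 *\<^sub>R w) - t * A w\<bar>
        = \<bar>F t - F 0 - t\<^sup>2 * A w\<bar>"
      unfolding s(3) using t by (simp add: abs_mult_pos' algebra_simps power2_eq_square)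
    moreover have "F t - F 0 = f (u + t *\<^sub>R v + t *\<^sub>R w) - f (u + t *\<^sub>R v) - f (u + t *\<^sub>R w) + f u"
      by (simp add: F_def)
    ultimately show "\<bar>f (u + t *\<^sub>R v + t *\<^sub>R w) - f (u + t *\<^sub>R v) - f (u + t *\<^sub>R w) + f u - t\<^sup>2 * A w\<bar> \<le> e * t\<^sup>2"
      by (simp add: power2_eq_square mult_ac)
  qed
qed

text \<open>
  Young's form of the equality of mixed derivatives: the second difference is symmetric in
  \<open>v\<close> and \<open>w\<close>.
\<close>

lemma mixed_derivatives_eq:
  fixes f :: "'a::real_normed_vector \<Rightarrow> real"
  assumes "open U" "u \<in> U"
    and f: "\<And>y. y \<in> U \<Longrightarrow> f differentiable (at y)"
    and A: "((\<lambda>y. frechet_derivative f (at y) v) has_derivative A) (at u)"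
    and B: "((\<lambda>y. frechet_derivative f (at y) w) has_derivative B) (at u)"
  shows "A w = B v"
proof (rule ccontr)
  assume "A w \<noteq> B v"
  then have e: "\<bar>A w - B v\<bar> / 3 > 0" (is "?e > 0") by simp
  obtain d1 where d1: "d1 > 0" "\<And>t. 0 < t \<Longrightarrow> t < d1 \<Longrightarrow>
    \<bar>f (u + t *\<^sub>R v + t *\<^sub>R w) - f (u + t *\<^sub>R v) - f (u + t *\<^sub>R w) + f u - t\<^sup>2 * A w\<bar> \<le> ?e * t\<^sup>2"
    using second_difference_bound[OF assms(1,2) f A e] by metis
  obtain d2 where d2: "d2 > 0" "\<And>t. 0 < t \<Longrightarrow> t < d2 \<Longrightarrow>
    \<bar>f (u + t *\<^sub>R w + t *\<^sub>R v) - f (u + t *\<^sub>R w) - f (u + t *\<^sub>R v) + f u - t\<^sup>2 * B v\<bar> \<le> ?e * t\<^sup>2"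
    using second_difference_bound[OF assms(1,2) f B e] by metis
  define t where "t = min d1 d2 / 2"
  have t: "0 < t" "t < d1" "t < d2" using d1(1) d2(1) by (auto simp: t_def)
  have comm: "u + t *\<^sub>R w + t *\<^sub>R v = u + t *\<^sub>R v + t *\<^sub>R w" by simp
  have "\<bar>t\<^sup>2 * A w - t\<^sup>2 * B v\<bar> \<le> 2 * (?e * t\<^sup>2)"
    using d1(2)[OF t(1,2)] d2(2)[OF t(1,3), unfolded comm] by linarith
  also have "\<dots> < 3 * (?e * t\<^sup>2)" using e t by (intro mult_strict_right_mono) auto
  also have "\<dots> = \<bar>t\<^sup>2 * A w - t\<^sup>2 * B v\<bar>"
    by (simp add: right_diff_distrib[symmetric] abs_mult)
  finally show False by simp
qed

lemma partial_commute:
  fixes f :: "real^2 \<Rightarrow> real^'m"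
  assumes "open U" "u \<in> U" "smooth_on U f"
  shows "partial a (partial b f) u = partial b (partial a f) u"
proof (rule vec_eq_iff[THEN iffD2], rule allI)
  fix i
  have df: "f differentiable (at y)" if "y \<in> U" for y
    using assms(3) that by (rule smooth_on_differentiable)
  have dp: "partial c f differentiable (at u)" for c
    using smooth_on_differentiable[OF smooth_on_partial[OF assms(3)] assms(2)] .
  have fc: "frechet_derivative (\<lambda>v. f v $ i) (at y) (axis c 1) = partial c f y $ i" if "y \<in> U" for y c
    using partial_component(1)[OF df[OF that]] unfolding partial_def by blast
  have D: "((\<lambda>y. frechet_derivative (\<lambda>v. f v $ i) (at y) (axis c 1)) has_derivative
      (\<lambda>h. frechet_derivative (partial c f) (at u) h $ i)) (at u)" for c
  proof -
    have "((\<lambda>y. partial c f y $ i) has_derivative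
      (\<lambda>h. frechet_derivative (partial c f) (at u) h $ i)) (at u)"
      by (rule bounded_linear.has_derivative[OF bounded_linear_vec_nth])
        (use dp frechet_derivative_works in blast)
    then show ?thesis
      by (rule has_derivative_transform_within_open[OF _ assms(1,2)]) (simp add: fc)
  qed
  have "frechet_derivative (partial b f) (at u) (axis a 1) $ i
      = frechet_derivative (partial a f) (at u) (axis b 1) $ i"
    by (rule mixed_derivatives_eq[OF assms(1,2) _ D D]) (rule partial_component(2)[OF df])
  then show "partial a (partial b f) u $ i = partial b (partial a f) u $ i"
    by (simp add: partial_def[symmetric])
qed

section \<open>Independence of the Poisson bracket of the parametrization\<close>

text \<open>
  If \<open>f \<circ> g = k\<close>, then \<open>g\<close> inherits differentiability from \<open>k\<close> although \<open>f\<close> maps into a space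
  of higher dimension: a left inverse \<open>h'\<close> of the derivative of \<open>f\<close> suffices. Applied to a
  parametrization \<open>f\<close>, this avoids straightening the surface by the inverse function theorem.
\<close>

lemma has_derivative_left_cancel:
  fixes f :: "'b::real_normed_vector \<Rightarrow> 'c::real_normed_vector" and g :: "'a::real_normed_vector \<Rightarrow> 'b"
  assumes f: "(f has_derivative f') (at (g y))" and k: "(k has_derivative k') (at y)"
    and h': "bounded_linear h'" and inv: "\<And>w. h' (f' w) = w"
    and g: "isCont g y" and fg: "eventually (\<lambda>z. f (g z) = k z) (nhds y)"
  shows "(g has_derivative (\<lambda>w. h' (k' w))) (at y)"
proof -
  interpret h': bounded_linear h' by fact
  interpret f': bounded_linear f' using f by (rule has_derivative_bounded_linear)
  interpret k': bounded_linear k' using k by (rule has_derivative_bounded_linear)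
  obtain H where H: "H > 0" "\<And>x. norm (h' x) \<le> norm x * H" using h'.pos_bounded by blast
  obtain C where C: "C > 0" "\<And>x. norm (k' x) \<le> norm x * C" using k'.pos_bounded by blast
  have fgy: "f (g y) = k y" using fg by (rule eventually_nhds_x_imp_x)
  have fest: "eventually (\<lambda>z. norm (k z - k y - f' (g z - g y)) \<le> e * norm (g z - g y)) (nhds y)"
    if "e > 0" for e
  proof -
    obtain d where d: "d > 0" "\<And>x. norm (x - g y) < d \<Longrightarrow> norm (f x - f (g y) - f' (x - g y)) \<le> e * norm (x - g y)"
      using f[unfolded has_derivative_within_alt] \<open>e > 0\<close> by auto
    have "eventually (\<lambda>z. dist (g z) (g y) < d) (nhds y)"
      using g d(1) unfolding continuous_at_eps_delta eventually_nhds_metric by blast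
    with fg show ?thesis
      by eventually_elim (metis d(2) fgy dist_norm)
  qed
  have kest: "eventually (\<lambda>z. norm (k z - k y - k' (z - y)) \<le> e * norm (z - y)) (nhds y)"
    if "e > 0" for e
  proof -
    obtain d where d: "d > 0" "\<And>x. norm (x - y) < d \<Longrightarrow> norm (k x - k y - k' (x - y)) \<le> e * norm (x - y)"
      using k[unfolded has_derivative_within_alt] \<open>e > 0\<close> by auto
    then show ?thesis unfolding eventually_nhds_metric dist_norm by blast
  qed
  \<comment> \<open>Both terms on the right are images under \<open>h'\<close> of linearization errors, of \<open>k\<close> and of \<open>f\<close>.\<close>
  have diff: "g z - g y - h' (k' (z - y))
      = h' (k z - k y - k' (z - y)) - h' (k z - k y - f' (g z - g y))" for z
    by (simp add: h'.diff inv)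
  \<comment> \<open>First \<open>g\<close> is shown to be Lipschitz at \<open>y\<close>: the error of \<open>f\<close> is at most half of
    \<open>norm (g z - g y)\<close> once \<open>g z\<close> is near \<open>g y\<close>, and can be absorbed in the left-hand side.\<close>
  define M where "M = 2 * (H * (C + 1))"
  have M: "M > 0" using H C by (simp add: M_def)
  have lip: "eventually (\<lambda>z. norm (g z - g y) \<le> M * norm (z - y)) (nhds y)"
  proof -
    have "1 / (2 * H) > 0" using H by simp
    from fest[OF this] kest[of 1]
    have "eventually (\<lambda>z. norm (k z - k y - f' (g z - g y)) \<le> 1 / (2 * H) * norm (g z - g y)
        \<and> norm (k z - k y - k' (z - y)) \<le> 1 * norm (z - y)) (nhds y)"
      by (intro eventually_conj) auto
    then show ?thesis
    proof eventually_elim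
      case (elim z)
      have "g z - g y = h' (k z - k y) - h' (k z - k y - f' (g z - g y))"
        by (simp add: h'.diff inv)
      then have "norm (g z - g y) \<le> norm (h' (k z - k y)) + norm (h' (k z - k y - f' (g z - g y)))"
        by (metis norm_triangle_ineq4)
      also have "norm (h' (k z - k y - f' (g z - g y))) \<le> 1 / (2 * H) * norm (g z - g y) * H"
        using H(2) elim H(1) by (meson mult_right_mono less_imp_le order_trans)
      also have "\<dots> = norm (g z - g y) / 2" using H by simp
      also have "norm (h' (k z - k y)) \<le> norm (k z - k y) * H" by (rule H)
      also have "norm (k z - k y) \<le> norm (k z - k y - k' (z - y)) + norm (k' (z - y))"
        by (metis diff_add_cancel norm_triangle_ineq)
      also have "\<dots> \<le> norm (z - y) + norm (z - y) * C" using elim C(2)[of "z - y"] by linarith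
      finally show ?case using H by (simp add: M_def algebra_simps mult_right_mono)
    qed
  qed
  show ?thesis
    unfolding has_derivative_within_alt
  proof (intro conjI allI impI)
    show "bounded_linear (\<lambda>w. h' (k' w))"
      by (rule bounded_linear_compose[OF h' k'.bounded_linear_axioms])
    fix e :: real assume e: "e > 0"
    define e1 where "e1 = e / (2 * H)"
    define e2 where "e2 = e / (2 * H * M)"
    have e12: "e1 > 0" "e2 > 0" using e H M by (auto simp: e1_def e2_def)
    have "eventually (\<lambda>z. norm (g z - g y - h' (k' (z - y))) \<le> e * norm (z - y)) (nhds y)"
      using fest[OF e12(2)] kest[OF e12(1)] lip
    proof eventually_elim
      case (elim z)
      have "norm (g z - g y - h' (k' (z - y)))
        \<le> norm (h' (k z - k y - k' (z - y))) + norm (h' (k z - k y - f' (g z - g y)))"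
        unfolding diff by (rule norm_triangle_ineq4)
      also have "norm (h' (k z - k y - k' (z - y))) \<le> e1 * norm (z - y) * H"
        using H elim(2) by (meson mult_right_mono less_imp_le order_trans)
      also have "norm (h' (k z - k y - f' (g z - g y))) \<le> e2 * norm (g z - g y) * H"
        using H elim(1) by (meson mult_right_mono less_imp_le order_trans)
      also have "e2 * norm (g z - g y) * H \<le> e2 * (M * norm (z - y)) * H"
        using elim(3) e12 H by (intro mult_right_mono mult_left_mono) auto
      also have "e1 * norm (z - y) * H + e2 * (M * norm (z - y)) * H = e * norm (z - y)"
        using H M by (simp add: e1_def e2_def field_simps)
      finally show ?case by simp
    qed
    then show "\<exists>d>0. \<forall>z\<in>UNIV. norm (z - y) < d \<longrightarrow> norm (g z - g y - h' (k' (z - y))) \<le> e * norm (z - y)"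
      unfolding eventually_nhds_metric dist_norm by blast
  qed
qed

lemma local_param_differentiable:
  assumes "local_param S U \<phi>" "u \<in> U"
  shows "\<phi> differentiable (at u)"
  using assms smooth_on_differentiable unfolding local_param_def by blast

lemma local_param_transition:
  fixes \<phi> \<psi> :: "real^2 \<Rightarrow> real^'m"
  assumes \<phi>: "local_param S U \<phi>" and \<psi>: "local_param S V \<psi>"
    and uv: "u \<in> U" "v \<in> V" "\<psi> v = \<phi> u"
  obtains \<tau> T where "(\<tau> has_derivative T) (at v)" "\<tau> v = u"
    "eventually (\<lambda>z. \<phi> (\<tau> z) = \<psi> z) (nhds v)"
proof -
  obtain \<kappa> where \<kappa>: "homeomorphism U (\<phi> ` U) \<phi> \<kappa>" using \<phi> unfolding local_param_def by blast
  define \<tau> where "\<tau> = \<kappa> \<circ> \<psi>"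
  have oV: "open V" using \<psi> unfolding local_param_def by blast
  have contpsi: "continuous_on V \<psi>"
    using local_param_differentiable[OF \<psi>] differentiable_imp_continuous_within
    by (meson continuous_at_imp_continuous_on)
  obtain W where W: "open W" "\<phi> ` U = S \<inter> W"
    using \<phi> unfolding local_param_def by (metis openin_open)
  define N where "N = V \<inter> \<psi> -` W"
  have N: "open N" unfolding N_def
    using continuous_open_preimage[OF contpsi oV W(1)] by simp
  have vN: "v \<in> N" using uv W by (auto simp: N_def)
  have img: "\<psi> ` N \<subseteq> \<phi> ` U"
    using \<psi> W(2) by (auto simp: N_def local_param_def)
  have "continuous_on N \<tau>" unfolding \<tau>_def
    using \<kappa> img contpsi by (intro continuous_on_compose) (auto simp: N_def homeomorphism_def intro: continuous_on_subset)
  then have cont: "isCont \<tau> v" using N vN continuous_on_eq_continuous_at by blast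
  have tv: "\<tau> v = u" using \<kappa> uv by (simp add: \<tau>_def homeomorphism_def)
  have ev: "eventually (\<lambda>z. \<phi> (\<tau> z) = \<psi> z) (nhds v)"
    unfolding eventually_nhds using N vN img \<kappa> by (auto simp: \<tau>_def homeomorphism_def intro!: exI[of _ N])
  have D: "(\<phi> has_derivative frechet_derivative \<phi> (at u)) (at u)"
    "(\<psi> has_derivative frechet_derivative \<psi> (at v)) (at v)"
    using local_param_differentiable[OF \<phi> uv(1)] local_param_differentiable[OF \<psi> uv(2)]
      frechet_derivative_works by blast+
  have "inj (frechet_derivative \<phi> (at u))" using \<phi> uv unfolding local_param_def by blast
  then obtain g where g: "linear g" "g \<circ> frechet_derivative \<phi> (at u) = id"
    using linear_injective_left_inverse[OF has_derivative_linear[OF D(1)]] by blast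
  have "bounded_linear g" using g(1) by (simp add: linear_conv_bounded_linear)
  moreover have "g (frechet_derivative \<phi> (at u) w) = w" for w using g(2) by (metis comp_apply id_apply)
  ultimately have "(\<tau> has_derivative (\<lambda>w. g (frechet_derivative \<psi> (at v) w))) (at v)"
    using has_derivative_left_cancel[OF _ D(2) _ _ cont ev] D(1) tv by metis
  then show thesis using that tv ev by blast
qed

lemma poisson_local_eq:
  "poisson_local \<omega> \<phi> f h u = (partial 1 (f \<circ> \<phi>) u * partial 2 (h \<circ> \<phi>) u
     - partial 2 (f \<circ> \<phi>) u * partial 1 (h \<circ> \<phi>) u) / rho \<omega> \<phi> u"
  by (simp add: poisson_local_def sum_2 eps2_def divide_simps)

lemma partial_transition:
  fixes F :: "real^2 \<Rightarrow> 'b::real_normed_vector"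
  assumes F: "F differentiable (at (\<tau> v))" and \<tau>: "(\<tau> has_derivative T) (at v)"
    and ev: "eventually (\<lambda>z. F (\<tau> z) = G z) (nhds v)"
  shows "partial a G v = T (axis a 1) $ 1 *\<^sub>R partial 1 F (\<tau> v) + T (axis a 1) $ 2 *\<^sub>R partial 2 F (\<tau> v)"
proof -
  have "((\<lambda>z. F (\<tau> z)) has_derivative (\<lambda>w. T w $ 1 *\<^sub>R partial 1 F (\<tau> v) + T w $ 2 *\<^sub>R partial 2 F (\<tau> v))) (at v)"
    by (rule has_derivative_compose[OF \<tau> has_derivative_partial(1)[OF F]])
  then have "(G has_derivative (\<lambda>w. T w $ 1 *\<^sub>R partial 1 F (\<tau> v) + T w $ 2 *\<^sub>R partial 2 F (\<tau> v))) (at v)"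
    by (rule has_derivative_transform_eventually)
      (use ev eventually_nhds_x_imp_x[OF ev] in \<open>auto simp: eventually_at_filter elim: eventually_mono\<close>)
  then show ?thesis by (rule partial_eqI)
qed

lemma tangent_partial:
  assumes "\<phi> differentiable (at u)"
  shows "tangent \<phi> u = {s *\<^sub>R partial 1 \<phi> u + t *\<^sub>R partial 2 \<phi> u | s t. True}"
proof -
  have "s *\<^sub>R partial 1 \<phi> u + t *\<^sub>R partial 2 \<phi> u
    = frechet_derivative \<phi> (at u) (s *\<^sub>R axis 1 1 + t *\<^sub>R axis 2 1)" for s t
    by (simp add: has_derivative_partial(2)[OF assms] axis_def)
  then have "{s *\<^sub>R partial 1 \<phi> u + t *\<^sub>R partial 2 \<phi> u | s t. True} \<subseteq> tangent \<phi> u"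
    unfolding tangent_def by auto
  moreover have "tangent \<phi> u \<subseteq> {s *\<^sub>R partial 1 \<phi> u + t *\<^sub>R partial 2 \<phi> u | s t. True}"
    unfolding tangent_def has_derivative_partial(2)[OF assms, abs_def] by blast
  ultimately show ?thesis by blast
qed

lemma partial_mem_tangent:
  "partial a \<phi> u \<in> tangent \<phi> u"
  by (simp add: partial_def tangent_def)

lemma partials_independent:
  assumes lp: "local_param S U \<phi>" and u: "u \<in> U"
    and 0: "s *\<^sub>R partial 1 \<phi> u + t *\<^sub>R partial 2 \<phi> u = 0"
  shows "s = 0" and "t = 0"
proof -
  note D = has_derivative_partial(2)[OF local_param_differentiable[OF lp u]]
  have "frechet_derivative \<phi> (at u) (s *\<^sub>R axis 1 1 + t *\<^sub>R axis 2 1) = frechet_derivative \<phi> (at u) 0"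
    using 0 by (simp add: D axis_def)
  moreover have "inj (frechet_derivative \<phi> (at u))" using lp u unfolding local_param_def by blast
  ultimately have "s *\<^sub>R axis 1 1 + t *\<^sub>R axis 2 1 = (0 :: real^2)" by (rule injD[rotated])
  then show "s = 0" and "t = 0" by (simp_all add: vec_eq_iff forall_2 axis_def)
qed

context
  fixes S :: "(real^'m) set" and \<omega> and U \<phi> u
  assumes sf: "symplectic_form S \<omega>" and lp: "local_param S U \<phi>" and u: "u \<in> U"
begin

lemma form_bilinear:
  assumes "v \<in> tangent \<phi> u" "w \<in> tangent \<phi> u" "z \<in> tangent \<phi> u"
  shows "\<omega> (\<phi> u) (c *\<^sub>R v + d *\<^sub>R w) z = c * \<omega> (\<phi> u) v z + d * \<omega> (\<phi> u) w z"
  using sf lp u assms unfolding symplectic_form_def by blast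

lemma form_antisym:
  assumes "v \<in> tangent \<phi> u" "w \<in> tangent \<phi> u"
  shows "\<omega> (\<phi> u) v w = - \<omega> (\<phi> u) w v"
  using sf lp u assms unfolding symplectic_form_def by blast

text \<open>
  A 2-form on a plane is determined by its value \<open>\<rho>\<close> on the frame; a change of frame multiplies
  that value by the determinant of the change.
\<close>

lemma form_frame_change:
  "\<omega> (\<phi> u) (a *\<^sub>R partial 1 \<phi> u + b *\<^sub>R partial 2 \<phi> u) (c *\<^sub>R partial 1 \<phi> u + d *\<^sub>R partial 2 \<phi> u)
    = (a * d - b * c) * rho \<omega> \<phi> u"
proof -
  let ?e1 = "partial 1 \<phi> u" and ?e2 = "partial 2 \<phi> u"
  have t: "?e1 \<in> tangent \<phi> u" "?e2 \<in> tangent \<phi> u" by (rule partial_mem_tangent)+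
  have z: "c *\<^sub>R ?e1 + d *\<^sub>R ?e2 \<in> tangent \<phi> u"
    using tangent_partial[OF local_param_differentiable[OF lp u]] by blast
  have self: "\<omega> (\<phi> u) w w = 0" if "w \<in> tangent \<phi> u" for w
    using form_antisym[OF that that] by simp
  have "\<omega> (\<phi> u) ?e1 (c *\<^sub>R ?e1 + d *\<^sub>R ?e2) = d * rho \<omega> \<phi> u"
    using form_antisym[OF t(1) z] form_antisym[OF t(1) t(2)] form_bilinear[OF t t(1), of c d] self[OF t(1)]
    by (simp add: rho_def form_coeff_def)
  moreover have "\<omega> (\<phi> u) ?e2 (c *\<^sub>R ?e1 + d *\<^sub>R ?e2) = - c * rho \<omega> \<phi> u"
    using form_antisym[OF t(2) z] form_bilinear[OF t t(2), of c d] self[OF t(2)]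
    by (simp add: rho_def form_coeff_def)
  ultimately show ?thesis
    using form_bilinear[OF t z, of a b] by (simp add: algebra_simps)
qed

lemma rho_ne_0: "rho \<omega> \<phi> u \<noteq> 0"
proof
  assume 0: "rho \<omega> \<phi> u = 0"
  have "\<forall>w\<in>tangent \<phi> u. \<omega> (\<phi> u) (partial 1 \<phi> u) w = 0"
    using form_frame_change[of 1 0] 0 tangent_partial[OF local_param_differentiable[OF lp u]] by auto
  then have "partial 1 \<phi> u = 0"
    using sf lp u partial_mem_tangent[of 1 \<phi> u] unfolding symplectic_form_def by blast
  then show False using partials_independent(1)[OF lp u, of 1 0] by simp
qed

end

text \<open>
  In another parametrization \<open>\<psi>\<close> the numerator of the bracket and \<open>\<rho>\<close> both acquire the Jacobian
  determinant \<open>d\<close> of the transition map, and \<open>d\<close> is nonzero because \<open>\<rho>\<close> vanishes in neither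
  parametrization. So the defining description of the bracket singles out a unique number.
\<close>

lemma poisson_eq_local:
  fixes S :: "(real^'m) set"
  assumes sf: "symplectic_form S \<omega>" and lp: "local_param S U \<phi>" and u: "u \<in> U"
    and f: "(f \<circ> \<phi>) differentiable (at u)" and h: "(h \<circ> \<phi>) differentiable (at u)"
  shows "poisson S \<omega> f h (\<phi> u) = poisson_local \<omega> \<phi> f h u"
proof -
  have "poisson_local \<omega> \<psi> f h v = poisson_local \<omega> \<phi> f h u"
    if \<psi>: "local_param S V \<psi>" and v: "v \<in> V" and uv: "\<psi> v = \<phi> u" for V \<psi> v
  proof -
    obtain \<tau> T where T: "(\<tau> has_derivative T) (at v)" "\<tau> v = u"
      and ev: "eventually (\<lambda>z. \<phi> (\<tau> z) = \<psi> z) (nhds v)"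
      using local_param_transition[OF lp \<psi> u v uv] by blast
    define J where "J = (\<lambda>a b. T (axis a 1) $ b)"
    have tr: "partial a (F \<circ> \<psi>) v = J a 1 *\<^sub>R partial 1 (F \<circ> \<phi>) u + J a 2 *\<^sub>R partial 2 (F \<circ> \<phi>) u"
      if "(F \<circ> \<phi>) differentiable (at u)" for F :: "real^'m \<Rightarrow> real" and a
    proof -
      have "eventually (\<lambda>z. (F \<circ> \<phi>) (\<tau> z) = (F \<circ> \<psi>) z) (nhds v)"
        using ev by eventually_elim simp
      from partial_transition[OF _ T(1) this] that T(2) show ?thesis
        unfolding J_def by metis
    qed
    have trp: "partial a \<psi> v = J a 1 *\<^sub>R partial 1 \<phi> u + J a 2 *\<^sub>R partial 2 \<phi> u" for a
      using partial_transition[of \<phi> \<tau> v T \<psi> a] local_param_differentiable[OF lp u] T ev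
      by (auto simp: J_def)
    define d where "d = J 1 1 * J 2 2 - J 1 2 * J 2 1"
    have rho: "rho \<omega> \<psi> v = d * rho \<omega> \<phi> u"
      unfolding d_def rho_def[of _ \<psi>] form_coeff_def uv trp by (rule form_frame_change[OF sf lp u])
    then have d: "d \<noteq> 0" using rho_ne_0[OF sf \<psi> v] by auto
    have "partial 1 (f \<circ> \<psi>) v * partial 2 (h \<circ> \<psi>) v - partial 2 (f \<circ> \<psi>) v * partial 1 (h \<circ> \<psi>) v
      = d * (partial 1 (f \<circ> \<phi>) u * partial 2 (h \<circ> \<phi>) u - partial 2 (f \<circ> \<phi>) u * partial 1 (h \<circ> \<phi>) u)"
      unfolding tr[OF f] tr[OF h] d_def by (simp add: algebra_simps)
    then show ?thesis using d by (simp add: poisson_local_eq rho)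
  qed
  then show ?thesis
    unfolding poisson_def using lp u by (intro the_equality) (metis, metis)
qed

section \<open>Contraction of antisymmetric symbols\<close>

text \<open>
  The numbering of the index type by \<open>0, \<dots>, m - 1\<close> that underlies \<open>eps\<close>.
\<close>

lemma bij_betw_card_lessThan:
  "bij_betw (\<lambda>i::'m::{finite,linorder}. card {..<i}) UNIV {..<CARD('m)}"
proof -
  have "strict_mono (\<lambda>i::'m. card {..<i})"
    by (intro strict_monoI psubset_card_mono) auto
  then have inj: "inj (\<lambda>i::'m. card {..<i})" by (rule strict_mono_imp_inj_on)
  have "range (\<lambda>i::'m. card {..<i}) \<subseteq> {..<CARD('m)}"
    by (auto intro!: psubset_card_mono)
  then have "range (\<lambda>i::'m. card {..<i}) = {..<CARD('m)}"
    by (intro card_subset_eq) (simp_all add: card_image[OF inj])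
  then show ?thesis using inj by (simp add: bij_betw_def)
qed

lemma bij_nth_card_lessThan:
  assumes "distinct js" "length js = CARD('m)"
  shows "bij (\<lambda>i::'m::{finite,linorder}. js ! card {..<i} :: 'm)"
proof -
  have "bij_betw (\<lambda>k. js ! k) {..<CARD('m)} (set js)"
    using bij_betw_nth[OF assms(1)] assms(2) by (metis lessThan_atLeast0)
  moreover have "set js = UNIV"
    using assms by (metis card_eq_UNIV_imp_eq_UNIV distinct_card finite)
  ultimately show ?thesis
    using bij_betw_trans[OF bij_betw_card_lessThan] by (auto simp: o_def)
qed

text \<open>
  Exchanging two list entries precomposes the permutation with the transposition of the two
  indices that have these positions.
\<close>

lemma eps_swap:
  fixes js :: "'m::{finite,linorder} list"
  assumes len: "length js = CARD('m)" and pq: "p < CARD('m)" "q < CARD('m)" "p \<noteq> q"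
  shows "eps (js[p := js ! q, q := js ! p]) = - eps js"
proof (cases "distinct js")
  case False
  then show ?thesis using assms by (simp add: eps_def)
next
  case True
  let ?c = "\<lambda>i::'m. card {..<i}"
  obtain i j where ij: "?c i = p" "?c j = q"
    using bij_betw_card_lessThan[where 'm='m] pq by (metis bij_betw_def imageE lessThan_iff)
  have inj: "?c k = ?c l \<longleftrightarrow> k = l" for k l
    using bij_betw_card_lessThan[where 'm='m] by (metis bij_betw_def injD)
  let ?f = "\<lambda>i. js ! ?c i" and ?js = "js[p := js ! q, q := js ! p]"
  have lt: "?c k < CARD('m)" for k by (auto intro!: psubset_card_mono)
  have "(\<lambda>k. ?js ! ?c k) = ?f \<circ> Transposition.transpose i j"
  proof
    fix k
    show "?js ! ?c k = (?f \<circ> Transposition.transpose i j) k"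
      using ij inj[of k i] inj[of k j] len pq lt[of k]
      by (auto simp: nth_list_update transpose_def)
  qed
  moreover have "permutation ?f"
    using bij_nth_card_lessThan[OF True len] by (simp add: permutation finite_subset[OF subset_UNIV])
  moreover have "i \<noteq> j" using ij pq by auto
  ultimately have "sign (\<lambda>k. ?js ! ?c k) = - sign ?f"
    by (simp add: sign_compose permutation_swap_id sign_swap_id)
  moreover have "distinct ?js" using True len pq by simp
  ultimately show ?thesis using True by (simp add: eps_def)
qed

lemma eps_swap12:
  assumes "length L + 3 = CARD('m::{finite,linorder})"
  shows "eps ([k, j, l] @ L :: 'm list) = - eps ([j, k, l] @ L)"
  using eps_swap[of "[j, k, l] @ L" 0 1] assms by simp

lemma eps_swap23:
  assumes "length L + 3 = CARD('m::{finite,linorder})"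
  shows "eps ([j, l, k] @ L :: 'm list) = - eps ([j, k, l] @ L)"
  using eps_swap[of "[j, k, l] @ L" 1 2] assms by (simp add: numeral_2_eq_2)

lemma eps_square: "eps js * eps js = (if distinct js then 1 else 0)"
  by (simp add: eps_def of_int_mult[symmetric] del: of_int_mult)

text \<open>
  The \<open>3 \<times> 3\<close> determinant of the matrix of values of \<open>B\<close>. With the Kronecker delta for \<open>B\<close> this is
  the generalized Kronecker symbol, with an inner product it is a Gram determinant.
\<close>

definition det3 :: "('a \<Rightarrow> 'b \<Rightarrow> real) \<Rightarrow> 'a \<Rightarrow> 'a \<Rightarrow> 'a \<Rightarrow> 'b \<Rightarrow> 'b \<Rightarrow> 'b \<Rightarrow> real" where
  "det3 B a b c a' b' c' =
     B a a' * (B b b' * B c c' - B b c' * B c b')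
     - B a b' * (B b a' * B c c' - B b c' * B c a')
     + B a c' * (B b a' * B c b' - B b b' * B c a')"

lemma card_distinct_extensions:
  assumes "distinct [j, k, l]" "CARD('m::{finite,linorder}) \<ge> 3"
  shows "card {L :: 'm list. length L = CARD('m) - 3 \<and> distinct ([j, k, l] @ L)} = fact (CARD('m) - 3)"
proof -
  have "{L :: 'm list. length L = CARD('m) - 3 \<and> distinct ([j, k, l] @ L)}
      = {xs. length xs = CARD('m) - 3 \<and> distinct xs \<and> set xs \<subseteq> - {j, k, l}}"
    using assms(1) by auto
  moreover have "card (- {j, k, l}) = CARD('m) - 3"
    using assms by (simp add: Compl_eq_Diff_UNIV card_Diff_subset)
  ultimately show ?thesis
    by (simp add: card_lists_distinct_length_eq fact_prod prod.atLeast_Suc_atMost)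
qed

text \<open>
  A list \<open>L\<close> contributes only if it enumerates both the complement of \<open>{j, k, l}\<close> and that of
  \<open>{i, r, n}\<close>, so the two sets must agree; then the triples differ by a permutation, which only
  produces a sign, and each of the \<open>(m - 3)!\<close> enumerations of the common complement contributes \<open>1\<close>.
\<close>

lemma eps_contraction:
  assumes m: "CARD('m::{finite,linorder}) \<ge> 3"
  shows "(\<Sum>L | length L = CARD('m) - 3. eps ([j, k, l] @ L) * eps ([i, r, n] @ L :: 'm list))
    = fact (CARD('m) - 3) * det3 (\<lambda>a b. if a = b then 1 else 0) j k l i r n"
    (is "?D j k l i r n = ?F j k l i r n")
proof (cases "distinct [j, k, l] \<and> distinct [i, r, n] \<and> {j, k, l} = {i, r, n}")
  case False
  have "eps ([j, k, l] @ L) * eps ([i, r, n] @ L) = 0" if L: "length L = CARD('m) - 3" for L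
  proof (rule ccontr)
    assume "\<not> ?thesis"
    then have d: "distinct ([j, k, l] @ L)" "distinct ([i, r, n] @ L)"
      by (auto simp: eps_def split: if_splits)
    have len: "length ([a, b, c] @ L) = CARD('m)" for a b c using L m by simp
    have "set ([j, k, l] @ L) = UNIV" "set ([i, r, n] @ L) = UNIV"
      using d len by (metis card_eq_UNIV_imp_eq_UNIV distinct_card finite)+
    then have "{j, k, l} = - set L" "{i, r, n} = - set L" using d by auto
    then have "{j, k, l} = {i, r, n}" by simp
    moreover have "distinct [j, k, l]" "distinct [i, r, n]"
      using d by (simp_all only: distinct_append)
    ultimately show False using False by blast
  qed
  then have "?D j k l i r n = 0" by (intro sum.neutral) auto
  moreover have "?F j k l i r n = 0"
  proof (cases "distinct [j, k, l] \<and> distinct [i, r, n]")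
    case True
    then have "{j, k, l} \<noteq> {i, r, n}" using False by blast
    moreover have "card {j, k, l} = card {i, r, n}" using True by simp
    ultimately have "\<not> {j, k, l} \<subseteq> {i, r, n}"
      using card_subset_eq[of "{i, r, n}" "{j, k, l}"] by blast
    then consider "j \<notin> {i, r, n}" | "k \<notin> {i, r, n}" | "l \<notin> {i, r, n}" by blast
    then show ?thesis by cases (simp_all add: det3_def)
  next
    case False
    then consider "j = k" | "j = l" | "k = l" | "i = r" | "i = n" | "r = n" by fastforce
    then show ?thesis by cases (simp_all add: det3_def)
  qed
  ultimately show ?thesis by simp
next
  case True
  have len: "length L + 3 = CARD('m)" if "length L = CARD('m) - 3" for L :: "'m list"
    using that m by simp
  have s12: "?D j k l r i n = - ?D j k l i r n" for i r n
  proof -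
    have "eps ([j, k, l] @ L) * eps ([r, i, n] @ L) = - (eps ([j, k, l] @ L) * eps ([i, r, n] @ L))"
      if "L \<in> {L. length L = CARD('m) - 3}" for L :: "'m list"
      using eps_swap12[of L r i n] len[of L] that by simp
    then show ?thesis unfolding sum_negf[symmetric] by (rule sum.cong[OF refl])
  qed
  have s23: "?D j k l i n r = - ?D j k l i r n" for i r n
  proof -
    have "eps ([j, k, l] @ L) * eps ([i, n, r] @ L) = - (eps ([j, k, l] @ L) * eps ([i, r, n] @ L))"
      if "L \<in> {L. length L = CARD('m) - 3}" for L :: "'m list"
      using eps_swap23[of L i n r] len[of L] that by simp
    then show ?thesis unfolding sum_negf[symmetric] by (rule sum.cong[OF refl])
  qed
  have base: "?D j k l j k l = fact (CARD('m) - 3)"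
  proof -
    have fin: "finite {L :: 'm list. length L = CARD('m) - 3}"
      using finite_lists_length_eq[OF finite[of "UNIV :: 'm set"]] by simp
    have "?D j k l j k l = real (card {L :: 'm list. length L = CARD('m) - 3 \<and> distinct ([j, k, l] @ L)})"
      unfolding eps_square using fin by (simp add: sum.If_cases Collect_conj_eq[symmetric] del: append.simps distinct_append)
    then show ?thesis using card_distinct_extensions[of j k l] True m by simp
  qed
  have t1: "?D j k l k j l = - fact (CARD('m) - 3)"
    using s12[of j k l] base by argo
  have t2: "?D j k l j l k = - fact (CARD('m) - 3)"
    using s23[of j k l] base by argo
  have t3: "?D j k l k l j = fact (CARD('m) - 3)"
    using s23[of k j l] t1 by argo
  have t4: "?D j k l l j k = fact (CARD('m) - 3)"
    using s12[of j l k] t2 by argo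
  have t5: "?D j k l l k j = - fact (CARD('m) - 3)"
    using s23[of l j k] t4 by argo
  have "i \<in> {j, k, l}" "r \<in> {j, k, l}" "n \<in> {j, k, l}" using True by blast+
  then consider "(i, r, n) = (j, k, l)" | "(i, r, n) = (k, j, l)" | "(i, r, n) = (j, l, k)"
    | "(i, r, n) = (l, j, k)" | "(i, r, n) = (k, l, j)" | "(i, r, n) = (l, k, j)"
    using True[THEN conjunct2, THEN conjunct1] by auto
  then show ?thesis
  proof cases
    case 1
    then show ?thesis using base True by (simp add: det3_def del: append.simps)
  next
    case 2
    then show ?thesis using t1 True by (simp add: det3_def del: append.simps)
  next
    case 3
    then show ?thesis using t2 True by (simp add: det3_def del: append.simps)
  next
    case 4
    then show ?thesis using t4 True by (simp add: det3_def del: append.simps)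
  next
    case 5
    then show ?thesis using t3 True by (simp add: det3_def del: append.simps)
  next
    case 6
    then show ?thesis using t5 True by (simp add: det3_def del: append.simps)
  qed
qed

definition vol :: "'m::{finite,linorder} list \<Rightarrow> real^'m::{finite,linorder} \<Rightarrow> real^'m::{finite,linorder} \<Rightarrow> real^'m::{finite,linorder} \<Rightarrow> real" where
  "vol L a b c = (\<Sum>j\<in>UNIV. \<Sum>k\<in>UNIV. \<Sum>l\<in>UNIV. eps ([j, k, l] @ L) * (a $ j * b $ k * c $ l))"

lemma sum3_product:
  fixes f :: "'i::finite \<Rightarrow> real" and g :: "'j::finite \<Rightarrow> real" and h :: "'k::finite \<Rightarrow> real"
  shows "(\<Sum>j\<in>UNIV. \<Sum>k\<in>UNIV. \<Sum>l\<in>UNIV. f j * g k * h l) = sum f UNIV * sum g UNIV * sum h UNIV"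
  by (simp only: sum_distrib_left[symmetric] sum_distrib_right[symmetric])

text \<open>
  The generalized Kronecker symbol contracted with three vectors is the determinant of their
  components; each of its six terms factorizes into three one-index sums.
\<close>

lemma sum3_delta:
  fixes a b c :: "real^'m"
  shows "(\<Sum>i\<in>UNIV. \<Sum>r\<in>UNIV. \<Sum>n\<in>UNIV.
      det3 (\<lambda>a b. if a = b then 1 else 0) j k l i r n * (a $ i * b $ r * c $ n))
    = det3 (\<lambda>j v. v $ j) j k l a b c"
proof -
  define d :: "'m \<Rightarrow> 'm \<Rightarrow> real" where "d = (\<lambda>a b. if a = b then 1 else 0)"
  have d: "(\<Sum>i\<in>UNIV. d j i * v $ i) = v $ j" for j v
    by (simp add: d_def if_distrib[of "\<lambda>x. x * _"] cong: if_cong)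
  have "det3 d j k l i r n * (a $ i * b $ r * c $ n) =
      (d j i * a $ i) * (d k r * b $ r) * (d l n * c $ n)
    - (d j i * a $ i) * (d l r * b $ r) * (d k n * c $ n)
    - (d k i * a $ i) * (d j r * b $ r) * (d l n * c $ n)
    + (d l i * a $ i) * (d j r * b $ r) * (d k n * c $ n)
    + (d k i * a $ i) * (d l r * b $ r) * (d j n * c $ n)
    - (d l i * a $ i) * (d k r * b $ r) * (d j n * c $ n)" for i r n
    by (simp add: det3_def algebra_simps)
  then have "(\<Sum>i\<in>UNIV. \<Sum>r\<in>UNIV. \<Sum>n\<in>UNIV. det3 d j k l i r n * (a $ i * b $ r * c $ n))
    = det3 (\<lambda>j v. v $ j) j k l a b c"
    by (simp only: sum.distrib sum_subtractf sum3_product d) (simp add: det3_def algebra_simps)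
  then show ?thesis by (simp only: d_def)
qed

lemma sum3_det3:
  fixes a b c a' b' c' :: "real^'m"
  shows "(\<Sum>j\<in>UNIV. \<Sum>k\<in>UNIV. \<Sum>l\<in>UNIV.
      det3 (\<lambda>j v. v $ j) j k l a' b' c' * (a $ j * b $ k * c $ l)) = det3 (\<bullet>) a b c a' b' c'"
proof -
  have *: "(\<Sum>j\<in>UNIV. \<Sum>k\<in>UNIV. \<Sum>l\<in>UNIV. (a $ j * x $ j) * (b $ k * y $ k) * (c $ l * z $ l))
      = (a \<bullet> x) * (b \<bullet> y) * (c \<bullet> z)" for x y z :: "real^'m"
    by (subst sum3_product) (simp add: inner_vec_def)
  have "det3 (\<lambda>j v. v $ j) j k l a' b' c' * (a $ j * b $ k * c $ l) =
      (a $ j * a' $ j) * (b $ k * b' $ k) * (c $ l * c' $ l)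
    - (a $ j * a' $ j) * (b $ k * c' $ k) * (c $ l * b' $ l)
    - (a $ j * b' $ j) * (b $ k * a' $ k) * (c $ l * c' $ l)
    + (a $ j * b' $ j) * (b $ k * c' $ k) * (c $ l * a' $ l)
    + (a $ j * c' $ j) * (b $ k * a' $ k) * (c $ l * b' $ l)
    - (a $ j * c' $ j) * (b $ k * b' $ k) * (c $ l * a' $ l)" for j k l
    by (simp add: det3_def algebra_simps)
  then show ?thesis
    by (simp only: sum.distrib sum_subtractf * ) (simp add: det3_def algebra_simps)
qed

text \<open>
  The Euclidean form of the identity for the inner product of two 3-vectors. Metrics of other signature
  enter by lowering the indices of \<open>a'\<close>, \<open>b'\<close>, \<open>c'\<close>.
\<close>

lemma vol_contraction:
  fixes a b c a' b' c' :: "real^'m::{finite,linorder}"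
  assumes m: "CARD('m) \<ge> 3"
  shows "(\<Sum>L | length L = CARD('m) - 3. vol L a b c * vol L a' b' c')
    = fact (CARD('m) - 3) * det3 (\<bullet>) a b c a' b' c'"
proof -
  let ?S = "{L :: 'm list. length L = CARD('m) - 3}"
  let ?d = "det3 (\<lambda>a b :: 'm. if a = b then 1 else (0::real))"
  have "(\<Sum>L\<in>?S. vol L a b c * vol L a' b' c')
    = (\<Sum>L\<in>?S. \<Sum>j\<in>UNIV. \<Sum>k\<in>UNIV. \<Sum>l\<in>UNIV. \<Sum>i\<in>UNIV. \<Sum>r\<in>UNIV. \<Sum>n\<in>UNIV.
        (eps ([j, k, l] @ L) * eps ([i, r, n] @ L)) * (a $ j * b $ k * c $ l) * (a' $ i * b' $ r * c' $ n))"
    unfolding vol_def by (simp only: sum_distrib_right) (simp only: sum_distrib_left mult_ac)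
  also have "\<dots> = (\<Sum>j\<in>UNIV. \<Sum>k\<in>UNIV. \<Sum>l\<in>UNIV. \<Sum>i\<in>UNIV. \<Sum>r\<in>UNIV. \<Sum>n\<in>UNIV. \<Sum>L\<in>?S.
        (eps ([j, k, l] @ L) * eps ([i, r, n] @ L)) * (a $ j * b $ k * c $ l) * (a' $ i * b' $ r * c' $ n))"
    unfolding sum.swap[of _ UNIV ?S] by (rule refl)
  also have "\<dots> = (\<Sum>j\<in>UNIV. \<Sum>k\<in>UNIV. \<Sum>l\<in>UNIV. \<Sum>i\<in>UNIV. \<Sum>r\<in>UNIV. \<Sum>n\<in>UNIV.
        fact (CARD('m) - 3) * ?d j k l i r n * (a $ j * b $ k * c $ l) * (a' $ i * b' $ r * c' $ n))"
    by (simp only: sum_distrib_right[symmetric] eps_contraction[OF m])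
  also have "\<dots> = fact (CARD('m) - 3) * (\<Sum>j\<in>UNIV. \<Sum>k\<in>UNIV. \<Sum>l\<in>UNIV.
        (\<Sum>i\<in>UNIV. \<Sum>r\<in>UNIV. \<Sum>n\<in>UNIV. ?d j k l i r n * (a' $ i * b' $ r * c' $ n)) * (a $ j * b $ k * c $ l))"
    by (simp only: sum_distrib_left sum_distrib_right mult_ac)
  also have "\<dots> = fact (CARD('m) - 3) * det3 (\<bullet>) a b c a' b' c'"
    by (simp only: sum3_delta sum3_det3)
  finally show ?thesis .
qed

lemma vol_linear:
  "vol L (a + a') b c = vol L a b c + vol L a' b c" "vol L (t *\<^sub>R a) b c = t * vol L a b c"
  "vol L a (b + b') c = vol L a b c + vol L a b' c" "vol L a (t *\<^sub>R b) c = t * vol L a b c"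
  "vol L a b (c + c') = vol L a b c + vol L a b c'" "vol L a b (t *\<^sub>R c) = t * vol L a b c"
  unfolding vol_def by (simp_all add: algebra_simps sum.distrib sum_distrib_left)

lemma vol_swap:
  fixes L :: "'m::{finite,linorder} list"
  assumes L: "length L + 3 = CARD('m)"
  shows "vol L b a c = - vol L a b c" and "vol L a c b = - vol L a b c"
proof -
  have "vol L b a c = (\<Sum>k\<in>UNIV. \<Sum>j\<in>UNIV. \<Sum>l\<in>UNIV. - (eps ([j, k, l] @ L) * (a $ j * b $ k * c $ l)))"
    unfolding vol_def by (intro sum.cong refl) (subst eps_swap12[OF L], simp)
  also have "\<dots> = (\<Sum>j\<in>UNIV. \<Sum>k\<in>UNIV. \<Sum>l\<in>UNIV. - (eps ([j, k, l] @ L) * (a $ j * b $ k * c $ l)))"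
    by (rule sum.swap)
  finally show "vol L b a c = - vol L a b c" by (simp add: vol_def sum_negf)
  have "vol L a c b = (\<Sum>j\<in>UNIV. \<Sum>l\<in>UNIV. \<Sum>k\<in>UNIV. - (eps ([j, k, l] @ L) * (a $ j * b $ k * c $ l)))"
    unfolding vol_def by (intro sum.cong refl) (subst eps_swap23[OF L], simp)
  also have "\<dots> = (\<Sum>j\<in>UNIV. \<Sum>k\<in>UNIV. \<Sum>l\<in>UNIV. - (eps ([j, k, l] @ L) * (a $ j * b $ k * c $ l)))"
    by (intro sum.cong refl sum.swap)
  finally show "vol L a c b = - vol L a b c" by (simp add: vol_def sum_negf)
qed

lemma vol_eq_0:
  fixes L :: "'m::{finite,linorder} list"
  assumes L: "length L + 3 = CARD('m)"
  shows "vol L a a c = 0" and "vol L a b b = 0" and "vol L a b a = 0"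
  using vol_swap[OF L, of a a c] vol_swap[OF L, of a b b] vol_swap[OF L, of b a a] vol_swap(2)[OF L, of b a a]
  by simp_all

section \<open>The Gauss equation and the mean curvature\<close>

definition lower :: "nat \<Rightarrow> real^'m::{finite,linorder} \<Rightarrow> real^'m::{finite,linorder}" where
  "lower \<nu> v = (\<chi> i. gbar \<nu> i * v $ i)"

lemma linear_lower: "linear (lower \<nu>)"
  by (rule linearI) (simp_all add: lower_def vec_eq_iff algebra_simps)

lemma inner_lower: "v \<bullet> lower \<nu> w = ambient_metric \<nu> v w"
  by (simp add: inner_vec_def lower_def ambient_metric_def mult_ac)

text \<open>
  Bilinearity supplies both the algebraic rules and the product rule for derivatives.
\<close>

lemma bounded_bilinear_ambient_metric: "bounded_bilinear (ambient_metric \<nu>)"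
proof -
  have "bounded_bilinear (\<lambda>v w. v \<bullet> lower \<nu> w)"
    by (intro bounded_bilinear.comp[OF bounded_bilinear_inner])
      (use linear_lower in \<open>simp_all add: linear_conv_bounded_linear\<close>)
  then show ?thesis by (simp add: inner_lower)
qed

lemma ambient_metric_sym: "ambient_metric \<nu> v w = ambient_metric \<nu> w v"
  by (simp add: ambient_metric_def mult_ac)

lemmas ambient_metric_linear =
  bounded_bilinear.add_left[OF bounded_bilinear_ambient_metric]
  bounded_bilinear.add_right[OF bounded_bilinear_ambient_metric]
  bounded_bilinear.diff_left[OF bounded_bilinear_ambient_metric]
  bounded_bilinear.diff_right[OF bounded_bilinear_ambient_metric]
  bounded_bilinear.minus_left[OF bounded_bilinear_ambient_metric]
  bounded_bilinear.minus_right[OF bounded_bilinear_ambient_metric]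
  bounded_bilinear.zero_left[OF bounded_bilinear_ambient_metric]
  bounded_bilinear.zero_right[OF bounded_bilinear_ambient_metric]
  bounded_bilinear.scaleR_left[OF bounded_bilinear_ambient_metric, simplified]
  bounded_bilinear.scaleR_right[OF bounded_bilinear_ambient_metric, simplified]

lemma ambient_metric_differentiable:
  assumes "f differentiable (at u)" "h differentiable (at u)"
  shows "(\<lambda>v. ambient_metric \<nu> (f v) (h v)) differentiable (at u)"
proof -
  obtain f' h' where "(f has_derivative f') (at u)" "(h has_derivative h') (at u)"
    using assms unfolding differentiable_def by blast
  from bounded_bilinear.FDERIV[OF bounded_bilinear_ambient_metric this]
  show ?thesis unfolding differentiable_def by blast
qed

lemma partial_ambient_metric:
  assumes "f differentiable (at u)" "h differentiable (at u)"
  shows "partial a (\<lambda>v. ambient_metric \<nu> (f v) (h v)) u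
    = ambient_metric \<nu> (partial a f u) (h u) + ambient_metric \<nu> (f u) (partial a h u)"
proof -
  obtain f' where f': "(f has_derivative f') (at u)" "\<And>a. partial a f u = f' (axis a 1)"
    using assms(1) partial_has_derivative by blast
  obtain h' where h': "(h has_derivative h') (at u)" "\<And>a. partial a h u = h' (axis a 1)"
    using assms(2) partial_has_derivative by blast
  show ?thesis
    by (simp add: partial_eqI[OF bounded_bilinear.FDERIV[OF bounded_bilinear_ambient_metric f'(1) h'(1)]] f' h')
qed

lemma matrix_inv_2:
  fixes A :: "real^2^2"
  assumes "det A \<noteq> 0"
  shows "matrix_inv A $ 1 $ 1 = A $ 2 $ 2 / det A" "matrix_inv A $ 1 $ 2 = - A $ 1 $ 2 / det A"
    "matrix_inv A $ 2 $ 1 = - A $ 2 $ 1 / det A" "matrix_inv A $ 2 $ 2 = A $ 1 $ 1 / det A"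
proof -
  define B :: "real^2^2" where "B = (\<chi> i j. if i = j then (if i = 1 then A $ 2 $ 2 else A $ 1 $ 1) / det A
    else - A $ i $ j / det A)"
  have B: "B $ 1 $ 1 = A $ 2 $ 2 / det A" "B $ 1 $ 2 = - A $ 1 $ 2 / det A"
    "B $ 2 $ 1 = - A $ 2 $ 1 / det A" "B $ 2 $ 2 = A $ 1 $ 1 / det A"
    by (simp_all add: B_def)
  have AB: "A ** B = mat 1"
  proof -
    have "A $ 1 $ 1 * A $ 2 $ 2 = det A + A $ 1 $ 2 * A $ 2 $ 1" by (simp add: det_2)
    then show ?thesis
      using assms by (simp add: vec_eq_iff matrix_matrix_mult_def forall_2 sum_2 mat_def B field_simps)
  qed
  have "invertible A" using assms by (simp add: invertible_det_nz)
  then have "matrix_inv A ** A = mat 1"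
    unfolding invertible_def matrix_inv_def by (rule someI2_ex) blast
  then have "matrix_inv A = B"
    using AB by (metis matrix_mul_assoc matrix_mul_lid matrix_mul_rid)
  then show "matrix_inv A $ 1 $ 1 = A $ 2 $ 2 / det A" "matrix_inv A $ 1 $ 2 = - A $ 1 $ 2 / det A"
    "matrix_inv A $ 2 $ 1 = - A $ 2 $ 1 / det A" "matrix_inv A $ 2 $ 2 = A $ 1 $ 1 / det A"
    using B by simp_all
qed

text \<open>
  The local geometry of a parametrized surface. In this locale \<open>e a\<close> are the coordinate
  vector fields, \<open>h a b\<close> the second derivatives of the parametrization, and \<open>h a b = W a b + II a b\<close> is
  the splitting into a tangential and a normal part. That \<open>W\<close>, defined with Christoffel symbols,
  really is the tangential part is the content of \<open>W_tangential\<close>.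
\<close>

locale nondegenerate_patch =
  fixes \<nu> :: nat and \<phi> :: "real^2 \<Rightarrow> real^'m::{finite,linorder}" and U :: "(real^2) set"
  assumes open_U: "open U" and smooth: "smooth_on U \<phi>"
    and det_ne_0: "\<And>u. u \<in> U \<Longrightarrow> metric_det \<nu> \<phi> u \<noteq> 0"
begin

abbreviation am :: "real^'m::{finite,linorder} \<Rightarrow> real^'m::{finite,linorder} \<Rightarrow> real" where
    "am \<equiv> ambient_metric \<nu>"

definition e :: "2 \<Rightarrow> real^2 \<Rightarrow> real^'m::{finite,linorder}" where "e a = partial a \<phi>"
definition h :: "2 \<Rightarrow> 2 \<Rightarrow> real^2 \<Rightarrow> real^'m::{finite,linorder}" where "h a b = partial a (partial b \<phi>)"
definition W :: "2 \<Rightarrow> 2 \<Rightarrow> real^2 \<Rightarrow> real^'m::{finite,linorder}" where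
  "W a b u = christoffel \<nu> \<phi> 1 a b u *\<^sub>R e 1 u + christoffel \<nu> \<phi> 2 a b u *\<^sub>R e 2 u"
definition II :: "2 \<Rightarrow> 2 \<Rightarrow> real^2 \<Rightarrow> real^'m::{finite,linorder}" where "II a b u = h a b u - W a b u"

lemma differentiable_phi: "u \<in> U \<Longrightarrow> \<phi> differentiable (at u)"
  using smooth smooth_on_differentiable by blast

lemma differentiable_e: "u \<in> U \<Longrightarrow> e a differentiable (at u)"
  unfolding e_def using smooth smooth_on_partial smooth_on_differentiable by blast

lemma differentiable_h: "u \<in> U \<Longrightarrow> h a b differentiable (at u)"
  unfolding h_def using smooth smooth_on_partial smooth_on_differentiable by blast

lemma h_sym: "u \<in> U \<Longrightarrow> h a b u = h b a u"
  unfolding h_def using partial_commute[OF open_U _ smooth] by blast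

lemma partial_e: "partial a (e b) = h a b"
  by (simp add: e_def h_def)

lemma partial_h_commute: "u \<in> U \<Longrightarrow> partial a (h b c) u = partial b (h a c) u"
  unfolding h_def using partial_commute[OF open_U _ smooth_on_partial[OF smooth]] by blast

lemma metric_matrix_nth: "metric_matrix \<nu> \<phi> u $ a $ b = am (e a u) (e b u)"
  by (simp add: metric_matrix_def e_def)

lemma metric_det_eq: "metric_det \<nu> \<phi> u = am (e 1 u) (e 1 u) * am (e 2 u) (e 2 u) - (am (e 1 u) (e 2 u))\<^sup>2"
  by (simp add: metric_det_def det_2 metric_matrix_nth power2_eq_square ambient_metric_sym[of _ "e 2 u" "e 1 u"])

lemma partial_metric:
  "u \<in> U \<Longrightarrow> partial d (\<lambda>v. metric_matrix \<nu> \<phi> v $ a $ b) u = am (h d a u) (e b u) + am (e a u) (h d b u)"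
  by (simp add: metric_matrix_nth partial_ambient_metric differentiable_e partial_e)

text \<open>
  The ambient metric is constant, so a derivative of \<open>g\<^sub>a\<^sub>b\<close> falls on \<open>e\<^sub>a\<close> or on \<open>e\<^sub>b\<close>; of the six
  resulting terms four cancel by the symmetry of \<open>h\<close>.
\<close>

lemma christoffel_first_kind:
  assumes "u \<in> U"
  shows "partial a (\<lambda>v. metric_matrix \<nu> \<phi> v $ b $ d) u + partial b (\<lambda>v. metric_matrix \<nu> \<phi> v $ a $ d) u
         - partial d (\<lambda>v. metric_matrix \<nu> \<phi> v $ a $ b) u = 2 * am (h a b u) (e d u)"
  by (simp add: partial_metric assms h_sym[OF assms, of b a] h_sym[OF assms, of d a]
      h_sym[OF assms, of d b] ambient_metric_sym[of _ "e b u" "h a d u"])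

lemma inverse_metric:
  assumes "u \<in> U"
  shows "matrix_inv (metric_matrix \<nu> \<phi> u) $ 1 $ 1 = am (e 2 u) (e 2 u) / metric_det \<nu> \<phi> u"
    "matrix_inv (metric_matrix \<nu> \<phi> u) $ 1 $ 2 = - am (e 1 u) (e 2 u) / metric_det \<nu> \<phi> u"
    "matrix_inv (metric_matrix \<nu> \<phi> u) $ 2 $ 1 = - am (e 1 u) (e 2 u) / metric_det \<nu> \<phi> u"
    "matrix_inv (metric_matrix \<nu> \<phi> u) $ 2 $ 2 = am (e 1 u) (e 1 u) / metric_det \<nu> \<phi> u"
  using matrix_inv_2[of "metric_matrix \<nu> \<phi> u"] det_ne_0[OF assms]
  by (simp_all add: metric_det_def metric_matrix_nth ambient_metric_sym[of _ "e 2 u" "e 1 u"])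

lemma christoffel_eq:
  assumes "u \<in> U"
  shows "christoffel \<nu> \<phi> 1 a b u = (am (e 2 u) (e 2 u) * am (h a b u) (e 1 u)
      - am (e 1 u) (e 2 u) * am (h a b u) (e 2 u)) / metric_det \<nu> \<phi> u"
    and "christoffel \<nu> \<phi> 2 a b u = (am (e 1 u) (e 1 u) * am (h a b u) (e 2 u)
      - am (e 1 u) (e 2 u) * am (h a b u) (e 1 u)) / metric_det \<nu> \<phi> u"
  unfolding christoffel_def christoffel_first_kind[OF assms]
  by (simp_all add: sum_2 inverse_metric[OF assms] diff_divide_distrib)

lemma differentiable_christoffel:
  assumes "u \<in> U"
  shows "christoffel \<nu> \<phi> c a b differentiable (at u)"
proof -
  have det: "(\<lambda>u. metric_det \<nu> \<phi> u) differentiable (at u)"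
    unfolding metric_det_eq power2_eq_square
    by (intro derivative_intros differentiable_mult differentiable_diff ambient_metric_differentiable differentiable_e assms)
  have "christoffel \<nu> \<phi> 1 a b differentiable (at u)"
    by (rule differentiable_cong[OF christoffel_eq(1) open_U assms], assumption)
      (intro differentiable_divide differentiable_mult differentiable_diff ambient_metric_differentiable
        differentiable_e differentiable_h det det_ne_0 assms)
  moreover have "christoffel \<nu> \<phi> 2 a b differentiable (at u)"
    by (rule differentiable_cong[OF christoffel_eq(2) open_U assms], assumption)
      (intro differentiable_divide differentiable_mult differentiable_diff ambient_metric_differentiable
        differentiable_e differentiable_h det det_ne_0 assms)
  ultimately show ?thesis using exhaust_2[of c] by metis
qed

lemma W_tangential:
  assumes "u \<in> U"
  shows "am (W a b u) (e c u) = am (h a b u) (e c u)"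
proof -
  have "am (W a b u) (e 1 u) = am (h a b u) (e 1 u)" "am (W a b u) (e 2 u) = am (h a b u) (e 2 u)"
    using det_ne_0[OF assms] unfolding W_def christoffel_eq[OF assms]
    by (simp_all add: ambient_metric_linear ambient_metric_sym[of _ "e 2 u" "e 1 u"] field_simps)
      (simp_all add: metric_det_eq algebra_simps power2_eq_square)
  then show ?thesis using exhaust_2[of c] by metis
qed

lemma II_normal:
  assumes "u \<in> U"
  shows "am (II a b u) (e c u) = 0" "am (e c u) (II a b u) = 0"
  using W_tangential[OF assms, of a b c]
  by (simp_all add: II_def ambient_metric_linear ambient_metric_sym[of _ "e c u" "W a b u"]
      ambient_metric_sym[of _ "e c u" "h a b u"])

lemma II_sym: "u \<in> U \<Longrightarrow> II a b u = II b a u"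
  unfolding II_def W_def by (simp add: christoffel_eq h_sym[of u a b])

lemma tangent_eq: "u \<in> U \<Longrightarrow> tangent \<phi> u = {s *\<^sub>R e 1 u + t *\<^sub>R e 2 u | s t. True}"
  using tangent_partial[OF differentiable_phi] by (simp add: e_def)

lemma tangent_nondegenerate:
  assumes "u \<in> U" "v \<in> tangent \<phi> u" "am v (e 1 u) = 0" "am v (e 2 u) = 0"
  shows "v = 0"
proof -
  obtain s t where v: "v = s *\<^sub>R e 1 u + t *\<^sub>R e 2 u" using assms tangent_eq by blast
  have eq: "s * am (e 1 u) (e 1 u) + t * am (e 1 u) (e 2 u) = 0" "s * am (e 1 u) (e 2 u) + t * am (e 2 u) (e 2 u) = 0"
    using assms(3,4) by (simp_all add: v ambient_metric_linear ambient_metric_sym[of _ "e 2 u" "e 1 u"])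
  have "s * metric_det \<nu> \<phi> u = 0" "t * metric_det \<nu> \<phi> u = 0"
    using eq unfolding metric_det_eq power2_eq_square by algebra+
  then show ?thesis using det_ne_0[OF assms(1)] v by simp
qed

text \<open>
  Uniqueness of the normal part holds because the difference of two candidates is tangential and
  orthogonal to the frame, hence zero by the nondegeneracy of the induced metric.
\<close>

lemma normal_part_h:
  assumes u: "u \<in> U"
  shows "normal_part \<nu> \<phi> u (h a b u) = II a b u"
  unfolding normal_part_def
proof (rule the_equality)
  have W: "W a b u \<in> tangent \<phi> u" unfolding W_def tangent_eq[OF u] by blast
  show "(\<forall>w\<in>tangent \<phi> u. am (II a b u) w = 0) \<and> h a b u - II a b u \<in> tangent \<phi> u"
    using W by (auto simp: tangent_eq[OF u] ambient_metric_linear II_normal[OF u]) (auto simp: II_def)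
  fix n assume n: "(\<forall>w\<in>tangent \<phi> u. am n w = 0) \<and> h a b u - n \<in> tangent \<phi> u"
  have e: "e c u \<in> tangent \<phi> u" for c unfolding e_def by (rule partial_mem_tangent)
  obtain s t where st: "h a b u - n = s *\<^sub>R e 1 u + t *\<^sub>R e 2 u"
    using n tangent_eq[OF u] by blast
  have "h a b u - n - W a b u = (s - christoffel \<nu> \<phi> 1 a b u) *\<^sub>R e 1 u
      + (t - christoffel \<nu> \<phi> 2 a b u) *\<^sub>R e 2 u"
    unfolding st W_def by (simp add: algebra_simps)
  then have "h a b u - n - W a b u \<in> tangent \<phi> u" unfolding tangent_eq[OF u] by blast
  moreover have "am (h a b u - n - W a b u) (e c u) = 0" for c
    using n e[of c] W_tangential[OF u, of a b c] by (simp add: ambient_metric_linear)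
  ultimately have "h a b u - n - W a b u = 0" using tangent_nondegenerate[OF u] by blast
  then show "n = II a b u" by (simp add: II_def algebra_simps)
qed

lemma shape_tensor_frame:
  assumes "u \<in> U"
  shows "shape_tensor \<nu> \<phi> (frame a) (frame b) u = II a b u"
  using normal_part_h[OF assms, of a b]
  by (simp add: shape_tensor_def frame_def h_def partial_def[abs_def])

text \<open>
  The covariant derivative is the ambient derivative minus its normal part: the image of the Christoffel
  term is \<open>W = h - II\<close>, and \<open>h\<close> is what the product rule for \<open>Y\<^sup>c e\<^sub>c\<close> produces.
\<close>

lemma levi_civita_frame:
  assumes u: "u \<in> U" and Y: "Y differentiable (at u)"
  shows "frechet_derivative \<phi> (at u) (levi_civita \<nu> \<phi> (frame a) Y u)
    = partial a (\<lambda>v. Y v $ 1 *\<^sub>R e 1 v + Y v $ 2 *\<^sub>R e 2 v) u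
      - (Y u $ 1 *\<^sub>R II a 1 u + Y u $ 2 *\<^sub>R II a 2 u)"
proof -
  have ax: "(\<Sum>x\<in>UNIV. \<Sum>b\<in>UNIV. christoffel \<nu> \<phi> c x b u * axis a 1 $ x * Y u $ b)
      = christoffel \<nu> \<phi> c a 1 u * Y u $ 1 + christoffel \<nu> \<phi> c a 2 u * Y u $ 2" for c
    using exhaust_2[of a] by (auto simp: sum_2 axis_def)
  have "partial a (\<lambda>v. Y v $ 1 *\<^sub>R e 1 v + Y v $ 2 *\<^sub>R e 2 v) u
    = (partial a Y u $ 1 *\<^sub>R e 1 u + Y u $ 1 *\<^sub>R h a 1 u) + (partial a Y u $ 2 *\<^sub>R e 2 u + Y u $ 2 *\<^sub>R h a 2 u)"
    by (simp add: partial_add partial_scaleR partial_component[OF Y] differentiable_e[OF u] partial_e)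
  then show ?thesis
    by (simp add: has_derivative_partial(2)[OF differentiable_phi[OF u]] levi_civita_def frame_def ax
        partial_def[symmetric] II_def W_def e_def[symmetric])
      (simp add: algebra_simps)
qed

lemma levi_civita_frame_frame:
  "levi_civita \<nu> \<phi> (frame a) (frame b) = (\<lambda>u. \<chi> c. christoffel \<nu> \<phi> c a b u)"
proof
  fix u
  have "(\<Sum>x\<in>UNIV. \<Sum>y\<in>UNIV. christoffel \<nu> \<phi> c x y u * axis a 1 $ x * axis b 1 $ y)
      = christoffel \<nu> \<phi> c a b u" for c
    using exhaust_2[of a] exhaust_2[of b] by (auto simp: sum_2 axis_def)
  then show "levi_civita \<nu> \<phi> (frame a) (frame b) u = (\<chi> c. christoffel \<nu> \<phi> c a b u)"
    by (simp add: levi_civita_def frame_def[abs_def] frechet_derivative_const)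
qed

text \<open>
  Pairing with the tangent vector \<open>e\<^sub>d\<close> turns the covariant derivative into \<open>\<langle>\<partial>\<^sub>a W\<^sub>b\<^sub>c, e\<^sub>d\<rangle>\<close>. This is found by differentiating
  \<open>\<langle>W\<^sub>b\<^sub>c, e\<^sub>d\<rangle> = \<langle>h\<^sub>b\<^sub>c, e\<^sub>d\<rangle>\<close>, which trades \<open>\<partial>\<^sub>a W\<^sub>b\<^sub>c\<close> for a third derivative of the parametrization and
  a product of normal parts.
\<close>

lemma levi_civita_twice:
  assumes u: "u \<in> U"
  shows "am (frechet_derivative \<phi> (at u) (levi_civita \<nu> \<phi> (frame a) (levi_civita \<nu> \<phi> (frame b) (frame c)) u)) (e d u)
    = am (partial a (h b c) u) (e d u) + am (II b c u) (II a d u)"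
proof -
  let ?Y = "\<lambda>u. (\<chi> i. christoffel \<nu> \<phi> i b c u) :: real^2"
  have Y: "?Y differentiable (at u)"
    unfolding differentiable_componentwise_within[of ?Y]
    using differentiable_christoffel[OF u] by (auto simp: Basis_vec_def inner_axis)
  have WY: "(\<lambda>v. ?Y v $ 1 *\<^sub>R e 1 v + ?Y v $ 2 *\<^sub>R e 2 v) = W b c" by (simp add: W_def[abs_def])
  have dW: "W b c differentiable (at u)"
    unfolding W_def[abs_def]
    by (intro differentiable_add differentiable_scaleR differentiable_christoffel differentiable_e u)
  have "am (frechet_derivative \<phi> (at u) (levi_civita \<nu> \<phi> (frame a) ?Y u)) (e d u) = am (partial a (W b c) u) (e d u)"
    unfolding levi_civita_frame[OF u Y] WY by (simp add: ambient_metric_linear II_normal[OF u])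
  also have "\<dots> = am (partial a (h b c) u) (e d u) + am (h b c u) (h a d u) - am (W b c u) (h a d u)"
  proof -
    have "partial a (\<lambda>v. am (W b c v) (e d v)) u = partial a (\<lambda>v. am (h b c v) (e d v)) u"
      by (rule partial_cong[OF W_tangential open_U u])
        (auto intro: ambient_metric_differentiable differentiable_h differentiable_e u)
    then show ?thesis
      by (simp add: partial_ambient_metric dW differentiable_h differentiable_e u partial_e)
  qed
  also have "\<dots> = am (partial a (h b c) u) (e d u) + am (II b c u) (h a d u)"
    by (simp add: II_def ambient_metric_linear)
  also have "am (II b c u) (h a d u) = am (II b c u) (II a d u)"
  proof -
    have "am (II b c u) (W a d u) = 0"
      unfolding W_def by (simp add: ambient_metric_linear II_normal[OF u])
    then show ?thesis by (simp add: II_def[of a d] ambient_metric_linear)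
  qed
  finally show ?thesis by (simp add: levi_civita_frame_frame)
qed

text \<open>
  The third derivatives from \<open>levi_civita_twice\<close> cancel in the commutator by the symmetry of mixed
  derivatives; the products of normal parts remain.
\<close>

lemma gauss_equation:
  assumes u: "u \<in> U"
  shows "gauss_curvature \<nu> \<phi> u
    = (am (II 1 1 u) (II 2 2 u) - am (II 1 2 u) (II 1 2 u)) / metric_det \<nu> \<phi> u"
proof -
  have "levi_civita \<nu> \<phi> (lie_bracket (frame 1) (frame 2)) (frame 1) u = 0"
    by (simp add: levi_civita_def lie_bracket_def frame_def[abs_def] frechet_derivative_const vec_eq_iff)
  moreover have "linear (frechet_derivative \<phi> (at u))"
    using differentiable_phi[OF u] by (rule linear_frechet_derivative)
  ultimately have "am (frechet_derivative \<phi> (at u) (curvature_tensor \<nu> \<phi> (frame 1) (frame 2) (frame 1) u)) (e 2 u)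
    = (am (partial 2 (h 1 1) u) (e 2 u) + am (II 1 1 u) (II 2 2 u))
      - (am (partial 1 (h 2 1) u) (e 2 u) + am (II 2 1 u) (II 1 2 u))"
    unfolding curvature_tensor_def levi_civita_twice[OF u, symmetric]
    by (simp add: linear_diff ambient_metric_linear)
  then show ?thesis
    unfolding gauss_curvature_def e_def[symmetric]
    by (simp add: partial_h_commute[OF u, of 1 2] II_sym[OF u, of 2 1])
qed

lemma mean_curvature_eq:
  assumes u: "u \<in> U"
  shows "mean_curvature \<nu> \<phi> u = (1 / (2 * metric_det \<nu> \<phi> u)) *\<^sub>R
    (am (e 2 u) (e 2 u) *\<^sub>R II 1 1 u - (2 * am (e 1 u) (e 2 u)) *\<^sub>R II 1 2 u + am (e 1 u) (e 1 u) *\<^sub>R II 2 2 u)"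
  unfolding mean_curvature_def
  by (simp add: sum_2 shape_tensor_frame[OF u] inverse_metric[OF u] II_sym[OF u, of 2 1] scaleR_add_right
      scaleR_diff_right vec_eq_iff field_simps)

end

section \<open>Contractions of brackets of coordinates\<close>

lemma sum6_product:
  fixes A :: "'m::finite \<Rightarrow> 'm \<Rightarrow> 'm \<Rightarrow> real" and B :: "'m \<Rightarrow> 'm \<Rightarrow> 'm \<Rightarrow> real"
  shows "(\<Sum>i\<in>UNIV. \<Sum>j\<in>UNIV. \<Sum>k\<in>UNIV. \<Sum>l\<in>UNIV. \<Sum>r\<in>UNIV. \<Sum>n\<in>UNIV. A j k l * B i r n)
    = (\<Sum>j\<in>UNIV. \<Sum>k\<in>UNIV. \<Sum>l\<in>UNIV. A j k l) * (\<Sum>i\<in>UNIV. \<Sum>r\<in>UNIV. \<Sum>n\<in>UNIV. B i r n)"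
  by (simp only: sum_distrib_left[symmetric] sum_distrib_right[symmetric])

lemma sum6_product':
  fixes A :: "'m::finite \<Rightarrow> 'm \<Rightarrow> 'm \<Rightarrow> real" and B :: "'m \<Rightarrow> real" and C :: "'m \<Rightarrow> 'm \<Rightarrow> real"
  shows "(\<Sum>i\<in>UNIV. \<Sum>j\<in>UNIV. \<Sum>k\<in>UNIV. \<Sum>l\<in>UNIV. \<Sum>r\<in>UNIV. \<Sum>n\<in>UNIV. B j * C k l * A i r n)
    = sum B UNIV * (\<Sum>k\<in>UNIV. \<Sum>l\<in>UNIV. C k l) * (\<Sum>i\<in>UNIV. \<Sum>r\<in>UNIV. \<Sum>n\<in>UNIV. A i r n)"
  by (simp only: sum_distrib_left[symmetric] sum_distrib_right[symmetric])

definition wedge :: "real^'m \<Rightarrow> real^'m \<Rightarrow> 'm \<Rightarrow> 'm \<Rightarrow> real" where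
  "wedge a b k l = a $ k * b $ l - b $ k * a $ l"

text \<open>
  With \<open>x\<close> and \<open>y\<close> the derivatives of \<open>a\<close> and \<open>b\<close>, and \<open>s\<close> that of \<open>\<sigma>\<close>, this is the derivative of
  \<open>\<sigma> (a \<and> b)\<close>.
\<close>

definition wedge_deriv :: "real \<Rightarrow> real \<Rightarrow> real^'m \<Rightarrow> real^'m \<Rightarrow> real^'m \<Rightarrow> real^'m \<Rightarrow> 'm \<Rightarrow> 'm \<Rightarrow> real" where
  "wedge_deriv s \<sigma> a b x y k l = s * wedge a b k l + \<sigma> * (wedge x b k l + wedge a y k l)"

definition eps_pairing :: "'m::{finite,linorder} list \<Rightarrow> real^'m::{finite,linorder} \<Rightarrow> ('m \<Rightarrow> 'm \<Rightarrow> real) \<Rightarrow> real" where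
  "eps_pairing L v Q = (\<Sum>j\<in>UNIV. \<Sum>k\<in>UNIV. \<Sum>l\<in>UNIV. eps ([j, k, l] @ L) * (v $ j * Q k l))"

lemma wedge_lower: "gbar \<nu> k * gbar \<nu> l * wedge a b k l = wedge (lower \<nu> a) (lower \<nu> b) k l"
  by (simp add: wedge_def lower_def algebra_simps)

lemma wedge_deriv_lower:
  "gbar \<nu> k * gbar \<nu> l * wedge_deriv s \<sigma> a b x y k l
    = wedge_deriv s \<sigma> (lower \<nu> a) (lower \<nu> b) (lower \<nu> x) (lower \<nu> y) k l"
  by (simp add: wedge_deriv_def wedge_lower[symmetric] algebra_simps)

lemma eps_pairing_wedge:
  fixes L :: "'m::{finite,linorder} list"
  assumes L: "length L + 3 = CARD('m)"
  shows "eps_pairing L v (wedge a b) = 2 * vol L v a b"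
proof -
  have "eps_pairing L v (wedge a b) = vol L v a b - vol L v b a"
    unfolding eps_pairing_def vol_def wedge_def by (simp add: algebra_simps sum_subtractf)
  then show ?thesis using vol_swap(2)[OF L, of v b a] by simp
qed

text \<open>
  In the product of \<open>a\<close> (or \<open>b\<close>) with the derivative of \<open>\<sigma> (a \<and> b)\<close>, every term that repeats \<open>a\<close> or \<open>b\<close>
  vanishes; in particular the derivative \<open>s\<close> of \<open>\<sigma>\<close> disappears.
\<close>

lemma eps_pairing_wedge_deriv:
  fixes L :: "'m::{finite,linorder} list"
  assumes L: "length L + 3 = CARD('m)"
  shows "eps_pairing L a (wedge_deriv s \<sigma> a b x y) = - 2 * \<sigma> * vol L a b x"
    and "eps_pairing L b (wedge_deriv s \<sigma> a b x y) = - 2 * \<sigma> * vol L a b y"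
proof -
  have "eps_pairing L v (wedge_deriv s \<sigma> a b x y) = s * eps_pairing L v (wedge a b)
      + \<sigma> * (eps_pairing L v (wedge x b) + eps_pairing L v (wedge a y))" for v
    unfolding eps_pairing_def wedge_deriv_def
    by (simp add: algebra_simps sum.distrib sum_distrib_left)
  then show "eps_pairing L a (wedge_deriv s \<sigma> a b x y) = - 2 * \<sigma> * vol L a b x"
    and "eps_pairing L b (wedge_deriv s \<sigma> a b x y) = - 2 * \<sigma> * vol L a b y"
    using vol_eq_0[OF L] vol_swap(2)[OF L, of a b x] vol_swap(1)[OF L, of a b y]
    by (simp_all add: eps_pairing_wedge[OF L])
qed

text \<open>
  The double brackets have the shape assumed for \<open>X\<close>. For a fixed multi-index each of the four terms of
  \<open>X i k l * X j r n\<close> separates into a sum over \<open>j, k, l\<close> and a sum over \<open>i, r, n\<close>; the signs of the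
  metric all go with the second one.
\<close>

lemma curvature_sum:
  fixes X :: "'m::{finite,linorder} \<Rightarrow> 'm \<Rightarrow> 'm \<Rightarrow> real" and a b :: "real^'m::{finite,linorder}"
  assumes X: "\<And>i k l. X i k l = \<sigma> * (a $ i * Q2 k l - b $ i * Q1 k l)"
  shows "(\<Sum>i\<in>UNIV. \<Sum>j\<in>UNIV. \<Sum>k\<in>UNIV. \<Sum>l\<in>UNIV. \<Sum>r\<in>UNIV. \<Sum>n\<in>UNIV.
      gbar \<nu> i * gbar \<nu> r * gbar \<nu> n * eps ([j, k, l] @ L) * eps ([i, r, n] @ L) * X i k l * X j r n)
    = \<sigma>\<^sup>2 *
      (eps_pairing L a Q2 * eps_pairing L (lower \<nu> a) (\<lambda>r n. gbar \<nu> r * gbar \<nu> n * Q2 r n)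
     - eps_pairing L b Q2 * eps_pairing L (lower \<nu> a) (\<lambda>r n. gbar \<nu> r * gbar \<nu> n * Q1 r n)
     - eps_pairing L a Q1 * eps_pairing L (lower \<nu> b) (\<lambda>r n. gbar \<nu> r * gbar \<nu> n * Q2 r n)
     + eps_pairing L b Q1 * eps_pairing L (lower \<nu> b) (\<lambda>r n. gbar \<nu> r * gbar \<nu> n * Q1 r n))"
proof -
  define A where "A = (\<lambda>v Q j k l. eps ([j, k, l] @ L) * ((v :: real^'m::{finite,linorder}) $ j * Q k l))"
  define B where "B = (\<lambda>v Q i r n. eps ([i, r, n] @ L) *
    (lower \<nu> (v :: real^'m::{finite,linorder}) $ i * (gbar \<nu> r * gbar \<nu> n * Q r n)))"
  have "gbar \<nu> i * gbar \<nu> r * gbar \<nu> n * eps ([j, k, l] @ L) * eps ([i, r, n] @ L) * X i k l * X j r n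
    = \<sigma>\<^sup>2 * (A a Q2 j k l * B a Q2 i r n - A b Q2 j k l * B a Q1 i r n
          - A a Q1 j k l * B b Q2 i r n + A b Q1 j k l * B b Q1 i r n)" for i j k l r n
    by (simp add: X A_def B_def lower_def power2_eq_square algebra_simps del: append.simps)
  then show ?thesis
    unfolding eps_pairing_def
    by (simp only: sum_distrib_left[of "\<sigma>\<^sup>2", symmetric] sum.distrib sum_subtractf sum6_product)
      (simp only: A_def B_def)
qed

text \<open>
  Here the sum over \<open>j\<close> separates as well and produces the entries of the induced metric. The free
  index \<open>k'\<close> carries no metric sign and becomes the axis vector.
\<close>

lemma mean_curvature_sum:
  fixes X :: "'m::{finite,linorder} \<Rightarrow> 'm \<Rightarrow> 'm \<Rightarrow> real" and a b :: "real^'m::{finite,linorder}"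
  assumes X: "\<And>i k l. X i k l = \<sigma> * (a $ i * Q2 k l - b $ i * Q1 k l)"
    and Y: "\<And>k l. Y k l = \<sigma> * wedge a b k l"
  shows "(\<Sum>i\<in>UNIV. \<Sum>j\<in>UNIV. \<Sum>k\<in>UNIV. \<Sum>l\<in>UNIV. \<Sum>r\<in>UNIV. \<Sum>n\<in>UNIV.
      gbar \<nu> j * gbar \<nu> k * gbar \<nu> l * eps ([i, r, n] @ L) * eps ([k', k, l] @ L) * Y i j * X j r n * Y k l)
    = \<sigma> ^ 3 *
      (ambient_metric \<nu> a b * (eps_pairing L a Q2 + eps_pairing L b Q1)
        - ambient_metric \<nu> b b * eps_pairing L a Q1 - ambient_metric \<nu> a a * eps_pairing L b Q2)
      * eps_pairing L (axis k' 1) (wedge (lower \<nu> a) (lower \<nu> b))"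
proof -
  define A where "A = (\<lambda>v Q i r n. eps ([i, r, n] @ L) * ((v :: real^'m::{finite,linorder}) $ i * Q r n))"
  define B where "B = (\<lambda>v w j. gbar \<nu> j * (v :: real^'m::{finite,linorder}) $ j * (w :: real^'m::{finite,linorder}) $ j)"
  define C where "C = (\<lambda>k l. eps ([k', k, l] @ L) * wedge (lower \<nu> a) (lower \<nu> b) k l)"
  have sC: "(\<Sum>k\<in>UNIV. \<Sum>l\<in>UNIV. C k l) = eps_pairing L (axis k' 1) (wedge (lower \<nu> a) (lower \<nu> b))"
  proof -
    have "eps_pairing L (axis k' 1) (wedge (lower \<nu> a) (lower \<nu> b))
      = (\<Sum>j\<in>UNIV. axis k' 1 $ j * (\<Sum>k\<in>UNIV. \<Sum>l\<in>UNIV.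
          eps ([j, k, l] @ L) * wedge (lower \<nu> a) (lower \<nu> b) k l))"
      unfolding eps_pairing_def by (simp only: sum_distrib_left mult.left_commute)
    also have "\<dots> = (\<Sum>j\<in>UNIV. if j = k' then (\<Sum>k\<in>UNIV. \<Sum>l\<in>UNIV.
          eps ([j, k, l] @ L) * wedge (lower \<nu> a) (lower \<nu> b) k l) else 0)"
      by (intro sum.cong refl) (simp add: axis_def)
    finally show ?thesis by (simp add: C_def)
  qed
  have "gbar \<nu> j * gbar \<nu> k * gbar \<nu> l * eps ([i, r, n] @ L) * eps ([k', k, l] @ L) * Y i j * X j r n * Y k l
    = \<sigma> ^ 3 * (B a b j * C k l * A a Q2 i r n + B a b j * C k l * A b Q1 i r n
      - B b b j * C k l * A a Q1 i r n - B a a j * C k l * A b Q2 i r n)" for i j k l r n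
    unfolding C_def wedge_lower[symmetric]
    by (simp add: X Y A_def B_def wedge_def[of a b i j] power3_eq_cube algebra_simps del: append.simps)
  then show ?thesis
    by (simp only: sum_distrib_left[of "\<sigma>^3", symmetric] sum.distrib sum_subtractf sum6_product' sC)
      (simp add: A_def B_def eps_pairing_def ambient_metric_def algebra_simps del: append.simps)
qed

text \<open>
  If \<open>g = 0\<close>, then \<open>g\<^sub>2\<^sub>2 e\<^sub>1 - g\<^sub>1\<^sub>2 e\<^sub>2\<close> and \<open>g\<^sub>1\<^sub>2 e\<^sub>1 - g\<^sub>1\<^sub>1 e\<^sub>2\<close> are tangent vectors orthogonal to the
  tangent plane, so nondegeneracy forces all \<open>g\<^sub>a\<^sub>b\<close> to vanish, and then \<open>e\<^sub>1\<close> itself is such a vector.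
\<close>

lemma metric_det_ne_0:
  assumes pr: "pseudo_riemannian_surface \<nu> S" and lp: "local_param S U \<phi>" and u: "u \<in> U"
  shows "metric_det \<nu> \<phi> u \<noteq> 0"
proof
  let ?g = "\<lambda>a b. ambient_metric \<nu> (partial a \<phi> u) (partial b \<phi> u)"
  assume "metric_det \<nu> \<phi> u = 0"
  then have 0: "?g 1 1 * ?g 2 2 = ?g 1 2 * ?g 1 2"
    by (simp add: metric_det_def det_2 metric_matrix_def ambient_metric_sym[of _ "partial 2 \<phi> u" "partial 1 \<phi> u"])
  note tan = tangent_partial[OF local_param_differentiable[OF lp u]]
  have nd: "s = 0 \<and> t = 0"
    if "s * ?g 1 1 + t * ?g 1 2 = 0" "s * ?g 1 2 + t * ?g 2 2 = 0" for s t
  proof -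
    let ?v = "s *\<^sub>R partial 1 \<phi> u + t *\<^sub>R partial 2 \<phi> u"
    have "ambient_metric \<nu> ?v w = 0" if wt: "w \<in> tangent \<phi> u" for w
    proof -
      obtain c d where w: "w = c *\<^sub>R partial 1 \<phi> u + d *\<^sub>R partial 2 \<phi> u" using wt tan by blast
      have "ambient_metric \<nu> ?v w = c * (s * ?g 1 1 + t * ?g 1 2) + d * (s * ?g 1 2 + t * ?g 2 2)"
        unfolding w by (simp add: ambient_metric_linear ambient_metric_sym[of _ "partial 2 \<phi> u" "partial 1 \<phi> u"] algebra_simps)
      then show ?thesis using \<open>s * ?g 1 1 + t * ?g 1 2 = 0\<close> \<open>s * ?g 1 2 + t * ?g 2 2 = 0\<close> by simp
    qed
    moreover have "?v \<in> tangent \<phi> u" unfolding tan by blast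
    ultimately have "?v = 0" using pr lp u unfolding pseudo_riemannian_surface_def by blast
    then show ?thesis using partials_independent[OF lp u] by blast
  qed
  have "?g 2 2 = 0 \<and> - ?g 1 2 = 0" by (rule nd) (use 0 in \<open>simp_all add: algebra_simps\<close>)
  moreover have "?g 1 2 = 0 \<and> - ?g 1 1 = 0" by (rule nd) (use 0 in \<open>simp_all add: algebra_simps\<close>)
  ultimately show False using nd[of 1 0] by simp
qed

lemma coord_comp_parametrization:
  assumes lp: "local_param S U \<phi>" and u: "u \<in> U"
  shows "(coord i \<circ> \<phi>) differentiable (at u)" "partial a (coord i \<circ> \<phi>) u = partial a \<phi> u $ i"
  using partial_component[OF local_param_differentiable[OF lp u]]
  by (simp_all add: o_def coord_def)

context
  fixes S :: "(real^'m) set" and \<omega> and U \<phi>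
  assumes sf: "symplectic_form S \<omega>" and lp: "local_param S U \<phi>"
begin

lemma rho_inverse_differentiable:
  assumes u: "u \<in> U"
  shows "(\<lambda>v. 1 / rho \<omega> \<phi> v) differentiable (at u)"
proof -
  have "smooth_on U (form_coeff \<omega> \<phi> 1 2)" using sf lp unfolding symplectic_form_def by blast
  then have "rho \<omega> \<phi> differentiable (at u)"
    using smooth_on_differentiable[OF _ u] by (simp add: rho_def[abs_def])
  then show ?thesis using rho_ne_0[OF sf lp u] by (intro differentiable_divide) auto
qed

lemma poisson_coord:
  assumes v: "v \<in> U"
  shows "poisson S \<omega> (coord k) (coord l) (\<phi> v)
    = 1 / rho \<omega> \<phi> v * wedge (partial 1 \<phi> v) (partial 2 \<phi> v) k l"
  using poisson_eq_local[OF sf lp v coord_comp_parametrization(1)[OF lp v] coord_comp_parametrization(1)[OF lp v], of k l]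
  by (simp add: poisson_local_eq coord_comp_parametrization(2)[OF lp v] wedge_def)

lemma partial_poisson_coord:
  assumes u: "u \<in> U"
  shows "(poisson S \<omega> (coord k) (coord l) \<circ> \<phi>) differentiable (at u)"
    and "partial c (poisson S \<omega> (coord k) (coord l) \<circ> \<phi>) u
      = wedge_deriv (partial c (\<lambda>v. 1 / rho \<omega> \<phi> v) u) (1 / rho \<omega> \<phi> u) (partial 1 \<phi> u) (partial 2 \<phi> u)
          (partial c (partial 1 \<phi>) u) (partial c (partial 2 \<phi>) u) k l"
proof -
  let ?F = "\<lambda>v. 1 / rho \<omega> \<phi> v * wedge (partial 1 \<phi> v) (partial 2 \<phi> v) k l"
  have oU: "open U" and sm: "smooth_on U \<phi>" using lp unfolding local_param_def by blast+
  have eq: "(poisson S \<omega> (coord k) (coord l) \<circ> \<phi>) v = ?F v" if "v \<in> U" for v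
    using poisson_coord[OF that] by simp
  have de: "partial a \<phi> differentiable (at u)" for a
    using smooth_on_differentiable[OF smooth_on_partial[OF sm] u] .
  note dc = partial_component(2)[OF de]
  have dw: "(\<lambda>v. wedge (partial 1 \<phi> v) (partial 2 \<phi> v) k l) differentiable (at u)"
    unfolding wedge_def by (intro differentiable_diff differentiable_mult dc)
  have pw: "partial c (\<lambda>v. wedge (partial 1 \<phi> v) (partial 2 \<phi> v) k l) u
    = wedge (partial c (partial 1 \<phi>) u) (partial 2 \<phi> u) k l + wedge (partial 1 \<phi> u) (partial c (partial 2 \<phi>) u) k l"
    unfolding wedge_def
    by (simp add: partial_diff partial_mult differentiable_mult dc partial_component(1)[OF de])
  have dF: "?F differentiable (at u)"
    by (rule differentiable_mult[OF rho_inverse_differentiable[OF u] dw])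
  have Fc: "partial c (poisson S \<omega> (coord k) (coord l) \<circ> \<phi>) u = partial c ?F u"
    by (rule partial_cong[OF eq oU u dF])
  show "(poisson S \<omega> (coord k) (coord l) \<circ> \<phi>) differentiable (at u)"
    by (rule differentiable_cong[OF eq oU u dF])
  show "partial c (poisson S \<omega> (coord k) (coord l) \<circ> \<phi>) u
      = wedge_deriv (partial c (\<lambda>v. 1 / rho \<omega> \<phi> v) u) (1 / rho \<omega> \<phi> u) (partial 1 \<phi> u) (partial 2 \<phi> u)
          (partial c (partial 1 \<phi>) u) (partial c (partial 2 \<phi>) u) k l"
    unfolding Fc partial_mult[OF rho_inverse_differentiable[OF u] dw] pw wedge_deriv_def
    by (rule refl)
qed

lemma poisson_coord_poisson_coord:
  assumes u: "u \<in> U"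
  shows "poisson S \<omega> (coord i) (poisson S \<omega> (coord k) (coord l)) (\<phi> u)
    = 1 / rho \<omega> \<phi> u * (partial 1 \<phi> u $ i * partial 2 (poisson S \<omega> (coord k) (coord l) \<circ> \<phi>) u
        - partial 2 \<phi> u $ i * partial 1 (poisson S \<omega> (coord k) (coord l) \<circ> \<phi>) u)"
  using poisson_eq_local[OF sf lp u coord_comp_parametrization(1)[OF lp u] partial_poisson_coord(1)[OF u], of i k l]
  by (simp add: poisson_local_eq coord_comp_parametrization(2)[OF lp u])

end

context nondegenerate_patch
begin

lemma vol_h:
  fixes L :: "'m list"
  assumes L: "length L + 3 = CARD('m)"
  shows "vol L (e 1 u) (e 2 u) (h a b u) = vol L (e 1 u) (e 2 u) (II a b u)"
    and "vol L (lower \<nu> (e 1 u)) (lower \<nu> (e 2 u)) (lower \<nu> (h a b u))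
      = vol L (lower \<nu> (e 1 u)) (lower \<nu> (e 2 u)) (lower \<nu> (II a b u))"
proof -
  have h: "h a b u = II a b u + (christoffel \<nu> \<phi> 1 a b u *\<^sub>R e 1 u + christoffel \<nu> \<phi> 2 a b u *\<^sub>R e 2 u)"
    by (simp add: II_def W_def)
  show "vol L (e 1 u) (e 2 u) (h a b u) = vol L (e 1 u) (e 2 u) (II a b u)"
    unfolding h by (simp add: vol_linear vol_eq_0[OF L])
  show "vol L (lower \<nu> (e 1 u)) (lower \<nu> (e 2 u)) (lower \<nu> (h a b u))
      = vol L (lower \<nu> (e 1 u)) (lower \<nu> (e 2 u)) (lower \<nu> (II a b u))"
    unfolding h linear_add[OF linear_lower] linear_scale[OF linear_lower]
    by (simp add: vol_linear vol_eq_0[OF L])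
qed

text \<open>
  Once \<open>h\<close> is replaced by its normal part, the Gram determinant is block triangular: its blocks are the
  Gram matrix of \<open>e\<^sub>1, e\<^sub>2\<close> and the product involving \<open>II\<close>. In the second formula the axis vector takes
  the place of a lowered vector, so the product is simply a component of \<open>II\<close>; moving the axis from
  the first to the last slot is an even permutation.
\<close>

lemma sum_vol_h:
  assumes m: "CARD('m) \<ge> 3" and u: "u \<in> U"
  shows "(\<Sum>L | length L = CARD('m) - 3. vol L (e 1 u) (e 2 u) (h a b u)
        * vol L (lower \<nu> (e 1 u)) (lower \<nu> (e 2 u)) (lower \<nu> (h c d u)))
      = fact (CARD('m) - 3) * (metric_det \<nu> \<phi> u * am (II a b u) (II c d u))"
    and "(\<Sum>L | length L = CARD('m) - 3. vol L (e 1 u) (e 2 u) (h a b u)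
        * vol L (axis k 1) (lower \<nu> (e 1 u)) (lower \<nu> (e 2 u)))
      = fact (CARD('m) - 3) * (metric_det \<nu> \<phi> u * II a b u $ k)"
proof -
  have L: "length L + 3 = CARD('m)" if "L \<in> {L. length L = CARD('m) - 3}" for L :: "'m list"
    using that m by simp
  have "(\<Sum>L | length L = CARD('m) - 3. vol L (e 1 u) (e 2 u) (h a b u)
        * vol L (lower \<nu> (e 1 u)) (lower \<nu> (e 2 u)) (lower \<nu> (h c d u)))
    = (\<Sum>L | length L = CARD('m) - 3. vol L (e 1 u) (e 2 u) (II a b u)
        * vol L (lower \<nu> (e 1 u)) (lower \<nu> (e 2 u)) (lower \<nu> (II c d u)))"
    by (intro sum.cong refl) (simp only: vol_h[OF L])
  also have "\<dots> = fact (CARD('m) - 3) * (metric_det \<nu> \<phi> u * am (II a b u) (II c d u))"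
    unfolding vol_contraction[OF m] metric_det_eq
    by (simp add: det3_def inner_lower II_normal[OF u] ambient_metric_sym[of _ "e 2 u" "e 1 u"]
        power2_eq_square algebra_simps)
  finally show "(\<Sum>L | length L = CARD('m) - 3. vol L (e 1 u) (e 2 u) (h a b u)
        * vol L (lower \<nu> (e 1 u)) (lower \<nu> (e 2 u)) (lower \<nu> (h c d u)))
      = fact (CARD('m) - 3) * (metric_det \<nu> \<phi> u * am (II a b u) (II c d u))" .
  have "(\<Sum>L | length L = CARD('m) - 3. vol L (e 1 u) (e 2 u) (h a b u)
        * vol L (axis k 1) (lower \<nu> (e 1 u)) (lower \<nu> (e 2 u)))
    = (\<Sum>L | length L = CARD('m) - 3. vol L (e 1 u) (e 2 u) (II a b u)
        * vol L (axis k 1) (lower \<nu> (e 1 u)) (lower \<nu> (e 2 u)))"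
    by (intro sum.cong refl) (simp only: vol_h[OF L])
  also have "\<dots> = fact (CARD('m) - 3) * (metric_det \<nu> \<phi> u * II a b u $ k)"
    unfolding vol_contraction[OF m] metric_det_eq
    by (simp add: det3_def inner_lower II_normal[OF u] ambient_metric_sym[of _ "e 2 u" "e 1 u"] inner_axis
        power2_eq_square algebra_simps)
  finally show "(\<Sum>L | length L = CARD('m) - 3. vol L (e 1 u) (e 2 u) (h a b u)
        * vol L (axis k 1) (lower \<nu> (e 1 u)) (lower \<nu> (e 2 u)))
      = fact (CARD('m) - 3) * (metric_det \<nu> \<phi> u * II a b u $ k)" .
qed

end

section \<open>Curvature in terms of Poisson brackets\<close>

theorem theorem3p7:
  fixes S :: "(real^'m::{finite,linorder}) set"
    and \<omega> :: "real^'m::{finite,linorder} \<Rightarrow> real^'m::{finite,linorder} \<Rightarrow> real^'m::{finite,linorder} \<Rightarrow> real"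
    and PB :: "(real^'m::{finite,linorder} \<Rightarrow> real) \<Rightarrow> (real^'m::{finite,linorder} \<Rightarrow> real) \<Rightarrow> real^'m::{finite,linorder} \<Rightarrow> real"
    and x :: "'m::{finite,linorder} \<Rightarrow> real^'m::{finite,linorder} \<Rightarrow> real"
    and U :: "(real^2) set" and \<phi> :: "real^2 \<Rightarrow> real^'m::{finite,linorder}" and u :: "real^2"
    and \<nu> p :: nat and \<rho> g :: real
  assumes "CARD('m) \<ge> 3" and "\<nu> \<le> CARD('m)" and "p = CARD('m) - 2"
    and "pseudo_riemannian_surface \<nu> S" and "orientable_surface S"
    and "symplectic_form S \<omega>"
    and "PB = poisson S \<omega>" and "x = coord"
    and "local_param S U \<phi>" and "u \<in> U"
    and "\<rho> = rho \<omega> \<phi> u" and "g = metric_det \<nu> \<phi> u"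
  shows "(gauss_curvature \<nu> \<phi> u =
      - (\<rho> ^ 4 / (8 * g ^ 2 * fact (p - 1))) *
        (\<Sum>L | length L = p - 1.
          \<Sum>i\<in>UNIV. \<Sum>j\<in>UNIV. \<Sum>k\<in>UNIV. \<Sum>l\<in>UNIV. \<Sum>r\<in>UNIV. \<Sum>n\<in>UNIV.
            gbar \<nu> i * gbar \<nu> r * gbar \<nu> n * eps ([j, k, l] @ L) * eps ([i, r, n] @ L) *
            PB (x i) (PB (x k) (x l)) (\<phi> u) * PB (x j) (PB (x r) (x n)) (\<phi> u)))
    \<and> (mean_curvature \<nu> \<phi> u =
      (\<rho> ^ 4 / (8 * g ^ 2 * fact (p - 1))) *\<^sub>R
        (\<Sum>L | length L = p - 1. \<Sum>k'\<in>UNIV.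
          \<Sum>i\<in>UNIV. \<Sum>j\<in>UNIV. \<Sum>k\<in>UNIV. \<Sum>l\<in>UNIV. \<Sum>r\<in>UNIV. \<Sum>n\<in>UNIV.
            (gbar \<nu> j * gbar \<nu> k * gbar \<nu> l * eps ([i, r, n] @ L) * eps ([k', k, l] @ L) *
             PB (x i) (x j) (\<phi> u) * PB (x j) (PB (x r) (x n)) (\<phi> u) * PB (x k) (x l) (\<phi> u))
            *\<^sub>R axis k' 1))"
proof -
  note m = assms(1) and sf = assms(6) and lp = assms(9) and u = assms(10)
  have "nondegenerate_patch \<nu> \<phi> U"
    using lp metric_det_ne_0[OF assms(4) lp] by unfold_locales (auto simp: local_param_def)
  then interpret nondegenerate_patch \<nu> \<phi> U .
  define \<sigma> where "\<sigma> = 1 / \<rho>"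
  define s where "s = (\<lambda>c. partial c (\<lambda>v. 1 / rho \<omega> \<phi> v) u)"
  define Q where "Q = (\<lambda>c. wedge_deriv (s c) \<sigma> (e 1 u) (e 2 u) (h c 1 u) (h c 2 u))"
  define Q' where "Q' = (\<lambda>c. wedge_deriv (s c) \<sigma> (lower \<nu> (e 1 u)) (lower \<nu> (e 2 u))
    (lower \<nu> (h c 1 u)) (lower \<nu> (h c 2 u)))"
  let ?X = "\<lambda>i k l. PB (x i) (PB (x k) (x l)) (\<phi> u)" and ?Y = "\<lambda>k l. PB (x k) (x l) (\<phi> u)"
  have \<rho>: "\<rho> \<noteq> 0" using rho_ne_0[OF sf lp u] assms(11) by simp
  have g: "g \<noteq> 0" using det_ne_0[OF u] assms(12) by simp
  have p: "p - 1 = CARD('m) - 3" using assms(3) by simp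
  have Y: "?Y k l = \<sigma> * wedge (e 1 u) (e 2 u) k l" for k l
    using poisson_coord[OF sf lp u] by (simp add: assms(7,8,11) \<sigma>_def e_def)
  have X: "?X i k l = \<sigma> * (e 1 u $ i * Q 2 k l - e 2 u $ i * Q 1 k l)" for i k l
    unfolding assms(7,8) poisson_coord_poisson_coord[OF sf lp u] partial_poisson_coord(2)[OF sf lp u]
    by (simp add: Q_def s_def \<sigma>_def assms(11) e_def h_def)
  let ?S = "{L :: 'm list. length L = p - 1}"
  have L: "length L + 3 = CARD('m)" if "L \<in> ?S" for L :: "'m list" using that m p by simp
  define T where "T = (\<lambda>L a b. vol L (e 1 u) (e 2 u) (h a b u))"
  define T' where "T' = (\<lambda>L a b. vol L (lower \<nu> (e 1 u)) (lower \<nu> (e 2 u)) (lower \<nu> (h a b u)))"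
  define V where "V = (\<lambda>L k. vol L (axis k 1) (lower \<nu> (e 1 u)) (lower \<nu> (e 2 u)))"
  \<comment> \<open>The pairing of \<open>e\<^sub>a\<close> with the derivative of the bracket in direction \<open>c\<close>, without and with
    lowered indices.\<close>
  have pair: "eps_pairing L (e a u) (Q c) = - 2 * \<sigma> * T L c a"
    "eps_pairing L (lower \<nu> (e a u)) (Q' c) = - 2 * \<sigma> * T' L c a" if "L \<in> ?S" for L a c
    unfolding Q_def Q'_def T_def T'_def
    using exhaust_2[of a] by (auto simp: eps_pairing_wedge_deriv[OF L[OF that]])
  have pairV: "eps_pairing L (axis k 1) (wedge (lower \<nu> (e 1 u)) (lower \<nu> (e 2 u))) = 2 * V L k"
    if "L \<in> ?S" for L k
    unfolding V_def by (rule eps_pairing_wedge[OF L[OF that]])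
  have lowQ: "(\<lambda>r n. gbar \<nu> r * gbar \<nu> n * Q c r n) = Q' c" for c
    by (simp only: Q_def Q'_def wedge_deriv_lower)
  have Tsym: "T L 2 1 = T L 1 2" "T' L 2 1 = T' L 1 2" for L
    by (simp_all add: T_def T'_def h_sym[OF u, of 2 1])
  define F where "F = (fact (p - 1) :: real)"
  have F: "F \<noteq> 0" by (simp add: F_def)
  \<comment> \<open>The prefactor of both formulas; it is inverse to the factor that the contractions produce.\<close>
  define C where "C = \<rho> ^ 4 / (8 * g ^ 2 * fact (p - 1))"
  have C: "C * (8 * \<sigma> ^ 4 * F * g\<^sup>2) = 1"
    unfolding C_def F_def[symmetric] \<sigma>_def using \<rho> g F by (simp add: power_divide)
  have TT: "(\<Sum>L\<in>?S. T L a b * T' L c d) = F * (g * am (II a b u) (II c d u))" for a b c d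
    unfolding T_def T'_def F_def p assms(12) by (rule sum_vol_h(1)[OF m u])
  have TV: "(\<Sum>L\<in>?S. T L a b * V L k) = F * (g * II a b u $ k)" for a b k
    unfolding T_def V_def F_def p assms(12) by (rule sum_vol_h(2)[OF m u])
  have "(\<Sum>L\<in>?S. \<Sum>i\<in>UNIV. \<Sum>j\<in>UNIV. \<Sum>k\<in>UNIV. \<Sum>l\<in>UNIV. \<Sum>r\<in>UNIV. \<Sum>n\<in>UNIV.
      gbar \<nu> i * gbar \<nu> r * gbar \<nu> n * eps ([j, k, l] @ L) * eps ([i, r, n] @ L) * ?X i k l * ?X j r n)
    = (\<Sum>L\<in>?S. 4 * \<sigma> ^ 4 * (2 * (T L 1 2 * T' L 1 2) - T L 2 2 * T' L 1 1 - T L 1 1 * T' L 2 2))"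
    unfolding curvature_sum[OF X] lowQ
    by (intro sum.cong refl) (simp add: pair Tsym power2_eq_square power4_eq_xxxx algebra_simps)
  also have "\<dots> = 4 * \<sigma> ^ 4 * (F * g * (2 * am (II 1 2 u) (II 1 2 u) - 2 * am (II 1 1 u) (II 2 2 u)))"
    by (simp only: sum_distrib_left[symmetric] sum_subtractf TT)
      (simp add: ambient_metric_sym[of _ "II 2 2 u" "II 1 1 u"] algebra_simps)
  also have "\<dots> = - 8 * \<sigma> ^ 4 * F * g\<^sup>2 * gauss_curvature \<nu> \<phi> u"
    unfolding gauss_equation[OF u] assms(12)[symmetric] using g by (simp add: power2_eq_square field_simps)
  finally have K: "gauss_curvature \<nu> \<phi> u = - C *
        (\<Sum>L\<in>?S. \<Sum>i\<in>UNIV. \<Sum>j\<in>UNIV. \<Sum>k\<in>UNIV. \<Sum>l\<in>UNIV. \<Sum>r\<in>UNIV. \<Sum>n\<in>UNIV.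
            gbar \<nu> i * gbar \<nu> r * gbar \<nu> n * eps ([j, k, l] @ L) * eps ([i, r, n] @ L) * ?X i k l * ?X j r n)"
    using C by algebra
  let ?Z = "\<lambda>L k'. \<Sum>i\<in>UNIV. \<Sum>j\<in>UNIV. \<Sum>k\<in>UNIV. \<Sum>l\<in>UNIV. \<Sum>r\<in>UNIV. \<Sum>n\<in>UNIV.
      gbar \<nu> j * gbar \<nu> k * gbar \<nu> l * eps ([i, r, n] @ L) * eps ([k', k, l] @ L) * ?Y i j * ?X j r n * ?Y k l"
  have Z: "(\<Sum>L\<in>?S. ?Z L k') = 8 * \<sigma> ^ 4 * F * g\<^sup>2 * mean_curvature \<nu> \<phi> u $ k'" for k'
  proof -
    have "(\<Sum>L\<in>?S. ?Z L k') = (\<Sum>L\<in>?S. 4 * \<sigma> ^ 4 *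
      (am (e 2 u) (e 2 u) * (T L 1 1 * V L k') + am (e 1 u) (e 1 u) * (T L 2 2 * V L k')
        - 2 * am (e 1 u) (e 2 u) * (T L 1 2 * V L k')))"
      unfolding mean_curvature_sum[OF X Y]
      by (intro sum.cong refl)
        (simp add: pair pairV Tsym power3_eq_cube power4_eq_xxxx algebra_simps)
    also have "\<dots> = 4 * \<sigma> ^ 4 * (F * g *
      (am (e 2 u) (e 2 u) * II 1 1 u $ k' + am (e 1 u) (e 1 u) * II 2 2 u $ k'
        - 2 * am (e 1 u) (e 2 u) * II 1 2 u $ k'))"
      by (simp only: sum_distrib_left[symmetric] sum_subtractf sum.distrib TV) (simp add: algebra_simps)
    also have "\<dots> = 8 * \<sigma> ^ 4 * F * g\<^sup>2 * mean_curvature \<nu> \<phi> u $ k'"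
      unfolding mean_curvature_eq[OF u] assms(12)[symmetric] using g
      by (simp add: power2_eq_square field_simps)
    finally show ?thesis .
  qed
  have "(\<Sum>L\<in>?S. \<Sum>k'\<in>UNIV. \<Sum>i\<in>UNIV. \<Sum>j\<in>UNIV. \<Sum>k\<in>UNIV. \<Sum>l\<in>UNIV. \<Sum>r\<in>UNIV. \<Sum>n\<in>UNIV.
      (gbar \<nu> j * gbar \<nu> k * gbar \<nu> l * eps ([i, r, n] @ L) * eps ([k', k, l] @ L) * ?Y i j * ?X j r n * ?Y k l)
        *\<^sub>R axis k' 1) = (8 * \<sigma> ^ 4 * F * g\<^sup>2) *\<^sub>R mean_curvature \<nu> \<phi> u" (is "?H = _")
  proof -
    have "?H = (\<Sum>L\<in>?S. \<Sum>k'\<in>UNIV. ?Z L k' *\<^sub>R axis k' 1)"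
      by (simp only: scaleR_left.sum)
    moreover have "(\<Sum>L\<in>?S. \<Sum>k'\<in>UNIV. z L k' *\<^sub>R axis k' 1) $ k = (\<Sum>L\<in>?S. z L k)" for z :: "'m list \<Rightarrow> 'm \<Rightarrow> real" and k
      by (simp add: axis_def if_distrib[of "\<lambda>x. _ * x"] cong: if_cong)
    ultimately show ?thesis by (simp only: vec_eq_iff Z vector_scaleR_component) simp
  qed
  then have "mean_curvature \<nu> \<phi> u = C *\<^sub>R ?H"
    using C by (simp only: scaleR_scaleR scaleR_one)
  with K show ?thesis unfolding C_def by (rule conjI)
qed

end
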